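(* Let $$\mathcal C':=\Big\{\sum_{j=1}^\infty a_j d^{-j}: a_j\in D\Big\}\subset[0,1],$$ and let $\nu$ denote its natural measure. Then, for every $f\in L^2_{\mathrm{loc}}(\mathbb R)$, $$\lim_{k\to\infty}\int f(x-d^{-k}t)\,d\nu(t)=f(x)$$ for Lebesgue-almost every $x\in\mathbb R$ (here $k$ runs through the nonnegative integers).
   Context: Let $d\ge 3$ be an integer and let $D\subsetneq\{0,1,\dots,d-1\}$ with $|D|\ge 2$ and $0\in D$. The natural measure $\nu$ on $\mathcal C'$ is the law of the random variable $Y:=\sum_{j\ge 1}\mathsf D_j d^{-j}$, where $(\mathsf D_j)_{j\ge 1}$ are independent random variables, each uniformly distributed on $D$. *)

theory Defs
  imports "HOL-Probability.Probability"
begin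

text \<open>The exponent is shifted because digit sequences are indexed from 0.\<close>

definition digit_sum :: "nat \<Rightarrow> (nat \<Rightarrow> nat) \<Rightarrow> real" where
  "digit_sum d a = (\<Sum>j. real (a j) / real d ^ Suc j)"

definition cantor_set :: "nat \<Rightarrow> nat set \<Rightarrow> real set" where
  "cantor_set d D = {digit_sum d a |a. \<forall>j. a j \<in> D}"

text \<open>Under the infinite product measure the coordinates are independent and each is
  uniformly distributed on \<open>D\<close>.\<close>

definition digit_measure :: "nat set \<Rightarrow> (nat \<Rightarrow> nat) measure" where
  "digit_measure D = (\<Pi>\<^sub>M j\<in>(UNIV :: nat set). uniform_count_measure D)"

definition natural_measure :: "nat \<Rightarrow> nat set \<Rightarrow> real measure" where
  "natural_measure d D = distr (digit_measure D) borel (digit_sum d)"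

definition L2_loc :: "(real \<Rightarrow> complex) set" where
  "L2_loc = {f. f \<in> borel_measurable lebesgue \<and>
     (\<forall>K. compact K \<longrightarrow> set_integrable lebesgue K (\<lambda>x. (norm (f x))\<^sup>2))}"

lemma digit_sum_image: "digit_sum d ` space (digit_measure D) = cantor_set d D"
  by (auto simp: digit_measure_def cantor_set_def space_PiM PiE_def Pi_def
      space_uniform_count_measure image_iff)

text \<open>\<open>distr\<close> returns the null measure on non-measurable maps, so measurability matters here.\<close>

lemma digit_sum_measurable: "digit_sum d \<in> borel_measurable (digit_measure D)"
proof -
  have "(\<lambda>a. real (a j)) \<in> borel_measurable (digit_measure D)" for j
  proof -
    have "(\<lambda>a. a j) \<in> measurable (digit_measure D) (uniform_count_measure D)"
      unfolding digit_measure_def by (rule measurable_component_singleton) simp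
    moreover have "real \<in> borel_measurable (uniform_count_measure D)"
      by (auto simp: measurable_def space_uniform_count_measure sets_uniform_count_measure)
    ultimately show ?thesis by (rule measurable_compose)
  qed
  then have "(\<lambda>a. \<Sum>j. real (a j) / real d ^ Suc j) \<in> borel_measurable (digit_measure D)"
    by (intro borel_measurable_suminf borel_measurable_divide borel_measurable_const)
  then show ?thesis by (simp add: digit_sum_def [abs_def])
qed

lemma prob_space_natural_measure:
  assumes "finite D" "D \<noteq> {}"
  shows "prob_space (natural_measure d D)"
proof -
  interpret product_prob_space "\<lambda>_ :: nat. uniform_count_measure D" UNIV
    by (intro product_prob_spaceI prob_space_uniform_count_measure assms)
  show ?thesis
    unfolding natural_measure_def digit_measure_def
    using digit_sum_measurable by (intro prob_space_distr) (simp add: digit_measure_def)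
qed

end

theory Submission
  imports Defs
begin

text \<open>Averages of continuous functions converge everywhere, so by density it is enough to have
  an \<open>L\<^sup>2\<close> maximal inequality for the averages over \<open>x - d\<^sup>-\<^sup>k t\<close>. By self-similarity of \<open>\<nu>\<close>,
  the averages with \<open>k \<le> K\<close> sampled on a lattice of mesh \<open>d\<^sup>-\<^sup>K\<close> are iterated digit averages of the
  finest one, which leaves a maximal inequality for periodic functions on the integers, uniform in
  the period and in \<open>K\<close>. After linearization and a discrete Fourier transform this is compared,
  one character at a time, with the same problem for the lazy symbol \<open>(1 + \<bar>s\<bar>\<^sup>2) / 2\<close> in place of
  the digit symbol \<open>s\<close>. With \<open>z\<close> the character raised to the power \<open>Gcd D\<close>, the two symbols differ
  by \<open>O(\<bar>1 - z\<bar>)\<close>, which is summable along the scales because \<open>z\<close> passes to \<open>z\<^sup>d\<close> and \<open>\<bar>1 - z\<bar>\<close>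
  grows geometrically while it is small. The lazy symbol is real and nonnegative and comes from a
  positive kernel, so for it the dual bound follows by expanding the square and using monotonicity.\<close>

section \<open>Energy identities along the scales\<close>

text \<open>The digit averages have nonnegative kernels too, but when their dual square is expanded,
  the operator linking two pieces depends on both of their scales. In the quadratic form with matrix
  \<open>B (max i j)\<close> it depends only on the later scale, so the earlier pieces can be summed
  and then dominated by the full sum. This form, called \<open>b\<close> below, is what
  \<open>(cmod (P 0))^2\<close> is compared with.

  Two energy identities drive the comparison. Their loss terms carry the weight
  \<open>\<beta> - |s|^2\<close> on suffix sums and \<open>1 - \<beta>\<close> on prefix sums.
  Taking \<open>\<beta>\<close> halfway between \<open>|s|^2\<close> and 1 makes both weights equal
  to \<open>(1 - |s|^2) / 2\<close>, so neither loss degenerates before the other. Since 0 is a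
  digit, this weight vanishes exactly when every digit power of the character is 1, that is, when
  its \<open>Gcd D\<close>-th power is 1; hence the distance to 1 is measured after raising to
  \<open>Gcd D\<close>.

  The obstacle is a mismatch of orders: the loss is quadratic in that distance, while the
  discrepancy \<open>cnj s - \<beta>\<close> is only linear, so the loss alone cannot absorb it near
  trivial characters.\<close>

lemma cmod_add_squared: "(cmod (a + b))\<^sup>2 = (cmod a)\<^sup>2 + (cmod b)\<^sup>2 + 2 * Re (a * cnj b)"
  unfolding cmod_power2 by (simp add: power2_eq_square algebra_simps)

text \<open>Below, \<open>g t\<close> are the Fourier coefficients of the pieces of the linearized maximal function,
  \<open>H\<close> their prefix sums, \<open>P\<close> their suffix sums weighted by the digit symbols \<open>s\<close>, and \<open>B\<close> the
  partial products of the lazy symbols \<open>\<beta>\<close>.\<close>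

lemma prefix_energy:
  fixes g H :: "nat \<Rightarrow> complex" and \<beta> B :: "nat \<Rightarrow> real"
  assumes H0: "H 0 = g 0" and HS: "\<And>t. H (Suc t) = H t + g (Suc t)"
    and B0: "B 0 = 1" and BS: "\<And>t. B (Suc t) = \<beta> t * B t"
  shows "(\<Sum>t<K. B t * (1 - \<beta> t) * (cmod (H t))\<^sup>2) + B K * (cmod (H K))\<^sup>2
    = (\<Sum>t\<le>K. B t * (cmod (g t))\<^sup>2) + 2 * (\<Sum>t<K. B (Suc t) * Re (H t * cnj (g (Suc t))))"
proof (induction K)
  case 0
  then show ?case by (simp add: H0)
next
  case (Suc K)
  have "B (Suc K) * (cmod (H (Suc K)))\<^sup>2 = B (Suc K) * (cmod (H K))\<^sup>2
      + B (Suc K) * (cmod (g (Suc K)))\<^sup>2 + 2 * (B (Suc K) * Re (H K * cnj (g (Suc K))))"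
    unfolding HS cmod_add_squared by (simp add: algebra_simps)
  moreover have "B K * (1 - \<beta> K) * (cmod (H K))\<^sup>2 = B K * (cmod (H K))\<^sup>2 - B (Suc K) * (cmod (H K))\<^sup>2"
    by (simp add: BS algebra_simps)
  ultimately show ?case using Suc.IH
    by (simp add: distrib_left)
qed

text \<open>\<open>B t * (cmod (P t))^2\<close> telescopes: \<open>B t * |s t|^2\<close> is
  \<open>B (Suc t)\<close> minus \<open>B t * (\<beta> t - |s t|^2)\<close>, and the subtracted part
  is the loss at scale \<open>t\<close>.\<close>

lemma suffix_energy:
  fixes g P s :: "nat \<Rightarrow> complex" and \<beta> B :: "nat \<Rightarrow> real"
  assumes PS: "\<And>t. t < K \<Longrightarrow> P t = g t + cnj (s t) * P (Suc t)" and PK: "P K = g K"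
    and B0: "B 0 = 1" and BS: "\<And>t. B (Suc t) = \<beta> t * B t"
  shows "(cmod (P 0))\<^sup>2 + (\<Sum>t<K. B t * (\<beta> t - (cmod (s t))\<^sup>2) * (cmod (P (Suc t)))\<^sup>2)
    = (\<Sum>t\<le>K. B t * (cmod (g t))\<^sup>2) + 2 * (\<Sum>t<K. B t * Re (cnj (s t) * P (Suc t) * cnj (g t)))"
proof -
  \<comment> \<open>The boundary term at \<open>n = K\<close> is \<open>B K * (cmod (g K))^2\<close>
    because \<open>P K = g K\<close>; it supplies the last term of the diagonal sum over
    \<open>t \<le> K\<close>.\<close>
  have "(cmod (P 0))\<^sup>2 + (\<Sum>t<n. B t * (\<beta> t - (cmod (s t))\<^sup>2) * (cmod (P (Suc t)))\<^sup>2) - B n * (cmod (P n))\<^sup>2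
    = (\<Sum>t<n. B t * (cmod (g t))\<^sup>2) + 2 * (\<Sum>t<n. B t * Re (cnj (s t) * P (Suc t) * cnj (g t)))"
    if "n \<le> K" for n
    using that
  proof (induction n)
    case 0
    then show ?case by (simp add: B0)
  next
    case (Suc n)
    have "P n = cnj (s n) * P (Suc n) + g n" using PS[of n] Suc.prems by simp
    then have "(cmod (P n))\<^sup>2 = (cmod (s n))\<^sup>2 * (cmod (P (Suc n)))\<^sup>2 + (cmod (g n))\<^sup>2
        + 2 * Re (cnj (s n) * P (Suc n) * cnj (g n))"
      by (simp only: cmod_add_squared norm_mult power_mult_distrib complex_mod_cnj)
    then have "B n * (cmod (P n))\<^sup>2 = B n * ((cmod (s n))\<^sup>2 * (cmod (P (Suc n)))\<^sup>2) + B n * (cmod (g n))\<^sup>2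
        + 2 * (B n * Re (cnj (s n) * P (Suc n) * cnj (g n)))"
      by (simp only: distrib_left mult.left_commute)
    moreover have "B n * (\<beta> n - (cmod (s n))\<^sup>2) * (cmod (P (Suc n)))\<^sup>2
        = B (Suc n) * (cmod (P (Suc n)))\<^sup>2 - B n * ((cmod (s n))\<^sup>2 * (cmod (P (Suc n)))\<^sup>2)"
      by (simp add: BS algebra_simps)
    ultimately show ?case using Suc by (simp add: distrib_left)
  qed
  from this[of K] show ?thesis
    by (simp add: PK lessThan_Suc_atMost[symmetric])
qed

text \<open>Summation by parts: \<open>P t - g t\<close> collects the later pieces and
  \<open>H t - g t\<close> the earlier ones, so both sums run over the same pairs and differ only in
  how the symbols between them are weighted. For \<open>s = \<beta>\<close> the right side vanishes,
  which settles the lazy case.\<close>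

lemma energy_difference:
  fixes g H P s :: "nat \<Rightarrow> complex" and \<beta> B :: "nat \<Rightarrow> real"
  assumes H0: "H 0 = g 0" and HS: "\<And>t. H (Suc t) = H t + g (Suc t)"
    and PS: "\<And>t. t < K \<Longrightarrow> P t = g t + cnj (s t) * P (Suc t)" and PK: "P K = g K"
    and BS: "\<And>t. B (Suc t) = \<beta> t * B t"
  shows "(\<Sum>t<K. B t * Re (cnj (s t) * P (Suc t) * cnj (g t))) - (\<Sum>t<K. B (Suc t) * Re (H t * cnj (g (Suc t))))
    = (\<Sum>t<K. B t * Re ((cnj (s t) - of_real (\<beta> t)) * P (Suc t) * cnj (H t)))"
proof -
  \<comment> \<open>The boundary term vanishes at both ends, at 0 because \<open>H 0 = g 0\<close>
    and at \<open>K\<close> because \<open>P K = g K\<close>.\<close>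
  have "(\<Sum>t<n. B t * Re ((cnj (s t) - of_real (\<beta> t)) * P (Suc t) * cnj (H t)))
    = (\<Sum>t<n. B t * Re (cnj (s t) * P (Suc t) * cnj (g t))) - (\<Sum>t<n. B (Suc t) * Re (H t * cnj (g (Suc t))))
      - B n * Re ((P n - g n) * cnj (H n - g n))" if "n \<le> K" for n
    using that
  proof (induction n)
    case 0
    then show ?case by (simp add: H0)
  next
    case (Suc n)
    have *: "P n - g n = cnj (s n) * P (Suc n)" using PS[of n] Suc.prems by simp
    have "B n * Re ((cnj (s n) - of_real (\<beta> n)) * P (Suc n) * cnj (H n))
       = B n * Re (cnj (s n) * P (Suc n) * cnj (g n)) + B n * Re (cnj (s n) * P (Suc n) * cnj (H n - g n))
         - B (Suc n) * Re (P (Suc n) * cnj (H n))"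
      by (simp add: BS algebra_simps)
    moreover have "B (Suc n) * Re (P (Suc n) * cnj (H n)) =
        B (Suc n) * Re ((P (Suc n) - g (Suc n)) * cnj (H (Suc n) - g (Suc n))) + B (Suc n) * Re (H n * cnj (g (Suc n)))"
      by (simp add: HS algebra_simps)
    ultimately show ?case using Suc by (simp add: *)
  qed
  from this[of K] show ?thesis by (simp add: PK)
qed

text \<open>The cross term is split unevenly so that the factor 5/4, multiplied by the 4/9 gained
  per scale below, stays under 1.\<close>

lemma norm_add_weighted:
  fixes a b :: complex
  shows "(cmod (a + b))\<^sup>2 \<le> 5/4 * (cmod a)\<^sup>2 + 5 * (cmod b)\<^sup>2"
proof -
  have "(cmod (a + b))\<^sup>2 \<le> (cmod a + cmod b)\<^sup>2"
    by (simp add: norm_triangle_ineq power_mono)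
  moreover have "0 \<le> (1/2 * cmod a - 2 * cmod b)\<^sup>2" by simp
  ultimately show ?thesis by (simp add: power2_eq_square algebra_simps)
qed

text \<open>The difference between the two energies is a sum weighted linearly by
  \<open>\<eta>\<close>. Where \<open>\<eta> > c0\<close>, the linear weight is at most
  \<open>1 / c0\<close> times the quadratic one and the loss pays for it. Where
  \<open>\<eta> \<le> c0\<close>, the term is bounded by a fixed fraction of the term at the next
  scale plus a diagonal term, and the fraction is absorbed after summation.\<close>

lemma lacunary_energy_comparison:
  fixes g H P s :: "nat \<Rightarrow> complex" and \<beta> B \<eta> :: "nat \<Rightarrow> real" and c0 c1 c2 :: real
  defines "N \<equiv> \<lambda>K. \<Sum>t\<le>K. B t * (cmod (g t))\<^sup>2"
  defines "b \<equiv> \<lambda>K. N K + 2 * (\<Sum>t<K. B (Suc t) * Re (H t * cnj (g (Suc t))))"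
  defines "A \<equiv> 3 * (1 / (c0 * c2)) + 15"
  assumes H0: "H 0 = g 0" and HS: "\<And>t. H (Suc t) = H t + g (Suc t)"
    and PS: "\<And>t. t < K \<Longrightarrow> P t = g t + cnj (s t) * P (Suc t)" and PK: "P K = g K"
    and B0: "B 0 = 1" and BS: "\<And>t. B (Suc t) = \<beta> t * B t"
    and c: "c0 > 0" "c1 > 0" "c2 > 0"
    and \<beta>: "\<And>t. 0 \<le> \<beta> t" "\<And>t. \<beta> t \<le> 1" and s: "\<And>t. cmod (s t) \<le> 1"
    and \<eta>: "\<And>t. 0 \<le> \<eta> t" "\<And>t. \<eta> t \<le> 2"
    and s\<beta>: "\<And>t. cmod (cnj (s t) - of_real (\<beta> t)) \<le> c1 * \<eta> t"
    and gap_s: "\<And>t. c2 * (\<eta> t)\<^sup>2 \<le> \<beta> t - (cmod (s t))\<^sup>2"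
    and gap_\<beta>: "\<And>t. c2 * (\<eta> t)\<^sup>2 \<le> 1 - \<beta> t"
    and lac: "\<And>t. \<eta> t \<le> c0 \<Longrightarrow> \<eta> t \<le> 2/5 * \<eta> (Suc t) \<and> 9/10 \<le> \<beta> t"
  shows "(cmod (P 0))\<^sup>2 \<le> (2 + 4 * c1\<^sup>2 * A\<^sup>2) * (b K + N K)"
proof -
  define a where "a = N K + 2 * (\<Sum>t<K. B t * Re (cnj (s t) * P (Suc t) * cnj (g t)))"
  \<comment> \<open>\<open>LP\<close> and \<open>LH\<close> are the losses, with weights at least
    \<open>c2 * \<eta>^2\<close>; \<open>XP\<close> and \<open>XH\<close> are the linearly weighted
    sums that have to be controlled by them.\<close>
  define LP where "LP = (\<Sum>t<K. B t * (\<beta> t - (cmod (s t))\<^sup>2) * (cmod (P (Suc t)))\<^sup>2)"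
  define LH where "LH = (\<Sum>t<K. B t * (1 - \<beta> t) * (cmod (H t))\<^sup>2)"
  define XP where "XP = (\<Sum>t<K. \<eta> t * B t * (cmod (P (Suc t)))\<^sup>2)"
  define XH where "XH = (\<Sum>t<K. \<eta> t * B t * (cmod (H t))\<^sup>2)"
  have Bnn: "0 \<le> B t" for t by (induction t) (auto simp: B0 BS \<beta>)
  have a_eq: "(cmod (P 0))\<^sup>2 + LP = a"
    unfolding a_def LP_def N_def by (rule suffix_energy[of K P g s B \<beta>, OF PS PK B0 BS])
  have b_eq: "LH + B K * (cmod (H K))\<^sup>2 = b K"
    unfolding b_def LH_def N_def by (rule prefix_energy[of H g B \<beta>, OF H0 HS B0 BS])
  have gs: "0 \<le> \<beta> t - (cmod (s t))\<^sup>2" for t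
    using gap_s[of t] c(3) by (smt (verit) mult_nonneg_nonneg zero_le_power2)
  have LP0: "0 \<le> LP" unfolding LP_def by (intro sum_nonneg mult_nonneg_nonneg Bnn gs) auto
  have LH0: "0 \<le> LH" unfolding LH_def using \<beta>(2) by (intro sum_nonneg mult_nonneg_nonneg Bnn) auto
  have N0: "0 \<le> N K" unfolding N_def by (intro sum_nonneg mult_nonneg_nonneg Bnn) auto
  have XP0: "0 \<le> XP" unfolding XP_def by (intro sum_nonneg mult_nonneg_nonneg Bnn \<eta>) auto
  have XH0: "0 \<le> XH" unfolding XH_def by (intro sum_nonneg mult_nonneg_nonneg Bnn \<eta>) auto
  have BK: "B K * (cmod (H K))\<^sup>2 \<ge> 0" by (simp add: Bnn)
  have bLH: "LH \<le> b K" "B K * (cmod (H K))\<^sup>2 \<le> b K" using b_eq BK LH0 by auto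
  have aLP: "LP \<le> a" using a_eq by (smt (verit) zero_le_power2)
  define \<kappa> where "\<kappa> = 1 / (c0 * c2)"
  have \<kappa>: "\<kappa> > 0" using c by (simp add: \<kappa>_def)
  have large: "\<eta> t * X \<le> \<kappa> * (Y * X)" if "\<eta> t > c0" "c2 * (\<eta> t)\<^sup>2 \<le> Y" "0 \<le> X" for t X Y
  proof -
    have "c0 * \<eta> t \<le> (\<eta> t)\<^sup>2" using that(1) \<eta>(1)[of t] by (simp add: power2_eq_square mult_right_mono)
    then have "c2 * (c0 * \<eta> t) \<le> c2 * (\<eta> t)\<^sup>2" using c by (simp add: mult_left_mono)
    also have "\<dots> \<le> Y" by fact
    finally have "\<eta> t \<le> \<kappa> * Y" using c by (simp add: \<kappa>_def field_simps)
    then have "\<eta> t * X \<le> \<kappa> * Y * X" using that(3) by (rule mult_right_mono)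
    then show ?thesis by simp
  qed
  \<comment> \<open>The gain 2/5 in \<open>\<eta>\<close> outweighs the factor 10/9 lost because
    \<open>B\<close> decreases: their product is 4/9.\<close>
  have small: "\<eta> t * B t * X \<le> 4/9 * (\<eta> (Suc t) * B (Suc t) * X)" if "\<eta> t \<le> c0" "0 \<le> X" for t X
  proof -
    have 1: "\<eta> t \<le> 2/5 * \<eta> (Suc t)" "9/10 \<le> \<beta> t" using lac[OF that(1)] by auto
    have "9/10 * B t \<le> B (Suc t)" using mult_right_mono[OF 1(2) Bnn[of t]] by (simp only: BS)
    then have "B t \<le> 10/9 * B (Suc t)" by simp
    with 1(1) have "\<eta> t * B t \<le> (2/5 * \<eta> (Suc t)) * (10/9 * B (Suc t))"
      using \<eta>(1)[of "Suc t"] Bnn[of t] by (intro mult_mono) auto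
    then have "\<eta> t * B t * X \<le> (2/5 * \<eta> (Suc t)) * (10/9 * B (Suc t)) * X"
      using that(2) by (rule mult_right_mono)
    then show ?thesis by (simp add: mult_ac)
  qed
  have \<eta>B: "\<eta> t * B t * X \<le> 2 * (B t * X)" if "0 \<le> X" for t X
  proof -
    have "\<eta> t * (B t * X) \<le> 2 * (B t * X)" using \<eta>(2) Bnn that by (intro mult_right_mono) auto
    then show ?thesis by (simp add: mult.assoc)
  qed
  have gB: "0 \<le> B t * (cmod (g t))\<^sup>2" for t by (simp add: Bnn)
  \<comment> \<open>These are the terms of \<open>XP\<close> and \<open>XH\<close> moved by one
    scale. \<open>p\<close> is cut off because the recursion for \<open>P\<close> stops at
    \<open>K\<close>; \<open>h\<close> is not, and reaches the term at \<open>K\<close>.\<close>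
  define p where "p = (\<lambda>t. if Suc t < K then \<eta> (Suc t) * B (Suc t) * (cmod (P (Suc (Suc t))))\<^sup>2 else 0)"
  define h where "h = (\<lambda>t. \<eta> (Suc t) * B (Suc t) * (cmod (H (Suc t)))\<^sup>2)"
  have NS: "(\<Sum>t<K. B (Suc t) * (cmod (g (Suc t)))\<^sup>2) \<le> N K"
  proof -
    have "N K = B 0 * (cmod (g 0))\<^sup>2 + (\<Sum>t<K. B (Suc t) * (cmod (g (Suc t)))\<^sup>2)"
      unfolding N_def by (simp only: lessThan_Suc_atMost[symmetric] sum.lessThan_Suc_shift)
    then show ?thesis by (simp add: B0)
  qed
  \<comment> \<open>In the small case the coefficients are 4/9 * 5/4 = 5/9 for the next scale and
    4/9 * 5 * 2 = 40/9, rounded up to 5, for the diagonal; the 2 bounds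
    \<open>\<eta>\<close>.\<close>
  have termP: "\<eta> t * B t * (cmod (P (Suc t)))\<^sup>2 \<le>
      \<kappa> * (B t * (\<beta> t - (cmod (s t))\<^sup>2) * (cmod (P (Suc t)))\<^sup>2) + 5/9 * p t + 5 * (B (Suc t) * (cmod (g (Suc t)))\<^sup>2)"
    if "t < K" for t
  proof (cases "\<eta> t > c0")
    case True
    have "p t \<ge> 0" by (auto simp: p_def intro!: mult_nonneg_nonneg Bnn \<eta>)
    moreover have "0 \<le> B (Suc t) * (cmod (g (Suc t)))\<^sup>2" by (simp add: Bnn)
    moreover have "\<eta> t * (B t * (cmod (P (Suc t)))\<^sup>2) \<le> \<kappa> * ((\<beta> t - (cmod (s t))\<^sup>2) * (B t * (cmod (P (Suc t)))\<^sup>2))"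
      by (rule large[OF True gap_s]) (simp add: Bnn)
    ultimately show ?thesis by (simp add: mult_ac)
  next
    case False
    have 0: "0 \<le> \<kappa> * (B t * (\<beta> t - (cmod (s t))\<^sup>2) * (cmod (P (Suc t)))\<^sup>2)"
      by (intro mult_nonneg_nonneg Bnn gs) (use \<kappa> in auto)
    have 1: "\<eta> t * B t * (cmod (P (Suc t)))\<^sup>2 \<le> 4/9 * (\<eta> (Suc t) * B (Suc t) * (cmod (P (Suc t)))\<^sup>2)"
      using False by (intro small) auto
    show ?thesis
    proof (cases "Suc t < K")
      case True
      have "(cmod (P (Suc t)))\<^sup>2 \<le> 5/4 * (cmod (cnj (s (Suc t)) * P (Suc (Suc t))))\<^sup>2 + 5 * (cmod (g (Suc t)))\<^sup>2"
        using norm_add_weighted[of "cnj (s (Suc t)) * P (Suc (Suc t))" "g (Suc t)"] PS[OF True] by (simp add: add.commute)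
      also have "(cmod (cnj (s (Suc t)) * P (Suc (Suc t))))\<^sup>2 \<le> (cmod (P (Suc (Suc t))))\<^sup>2"
        using s[of "Suc t"] by (intro power_mono) (auto simp: norm_mult mult_left_le_one_le)
      finally have "\<eta> (Suc t) * B (Suc t) * (cmod (P (Suc t)))\<^sup>2 \<le> \<eta> (Suc t) * B (Suc t) * (5/4 * (cmod (P (Suc (Suc t))))\<^sup>2 + 5 * (cmod (g (Suc t)))\<^sup>2)"
        by (intro mult_left_mono) (auto intro!: mult_nonneg_nonneg Bnn \<eta>)
      also have "\<dots> = 5/4 * p t + 5 * (\<eta> (Suc t) * B (Suc t) * (cmod (g (Suc t)))\<^sup>2)"
        using True by (simp add: p_def algebra_simps)
      also have "\<dots> \<le> 5/4 * p t + 5 * (2 * (B (Suc t) * (cmod (g (Suc t)))\<^sup>2))"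
        by (intro add_left_mono mult_left_mono \<eta>B) auto
      finally show ?thesis using 0 1 gB[of "Suc t"] by simp
    next
      case False
      then have "Suc t = K" using that by simp
      then have "\<eta> (Suc t) * B (Suc t) * (cmod (P (Suc t)))\<^sup>2 \<le> 2 * (B (Suc t) * (cmod (g (Suc t)))\<^sup>2)"
        using \<eta>B[of "(cmod (g (Suc t)))\<^sup>2" "Suc t"] PK by simp
      moreover have "p t = 0" using False by (simp add: p_def)
      ultimately show ?thesis using 0 1 gB[of "Suc t"] by simp
    qed
  qed
  have termH: "\<eta> t * B t * (cmod (H t))\<^sup>2 \<le>
      \<kappa> * (B t * (1 - \<beta> t) * (cmod (H t))\<^sup>2) + 5/9 * h t + 5 * (B (Suc t) * (cmod (g (Suc t)))\<^sup>2)" for t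
  proof (cases "\<eta> t > c0")
    case True
    have "h t \<ge> 0" by (auto simp: h_def intro!: mult_nonneg_nonneg Bnn \<eta>)
    moreover have "0 \<le> B (Suc t) * (cmod (g (Suc t)))\<^sup>2" by (simp add: Bnn)
    moreover have "\<eta> t * (B t * (cmod (H t))\<^sup>2) \<le> \<kappa> * ((1 - \<beta> t) * (B t * (cmod (H t))\<^sup>2))"
      by (rule large[OF True gap_\<beta>]) (simp add: Bnn)
    ultimately show ?thesis by (simp add: mult_ac)
  next
    case False
    have 0: "0 \<le> \<kappa> * (B t * (1 - \<beta> t) * (cmod (H t))\<^sup>2)"
      by (intro mult_nonneg_nonneg Bnn) (use \<kappa> \<beta> in auto)
    have 1: "\<eta> t * B t * (cmod (H t))\<^sup>2 \<le> 4/9 * (\<eta> (Suc t) * B (Suc t) * (cmod (H t))\<^sup>2)"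
      using False by (intro small) auto
    have "(cmod (H t))\<^sup>2 \<le> 5/4 * (cmod (H (Suc t)))\<^sup>2 + 5 * (cmod (g (Suc t)))\<^sup>2"
      using norm_add_weighted[of "H (Suc t)" "- g (Suc t)"] by (simp add: HS)
    then have "\<eta> (Suc t) * B (Suc t) * (cmod (H t))\<^sup>2 \<le> \<eta> (Suc t) * B (Suc t) * (5/4 * (cmod (H (Suc t)))\<^sup>2 + 5 * (cmod (g (Suc t)))\<^sup>2)"
      by (intro mult_left_mono) (auto intro!: mult_nonneg_nonneg Bnn \<eta>)
    also have "\<dots> = 5/4 * h t + 5 * (\<eta> (Suc t) * B (Suc t) * (cmod (g (Suc t)))\<^sup>2)"
      by (simp add: h_def algebra_simps)
    also have "\<dots> \<le> 5/4 * h t + 5 * (2 * (B (Suc t) * (cmod (g (Suc t)))\<^sup>2))"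
      by (intro add_left_mono mult_left_mono \<eta>B) auto
    finally show ?thesis using 0 1 gB[of "Suc t"] by simp
  qed
  have sum_p: "(\<Sum>t<K. p t) \<le> XP"
  proof (cases K)
    case 0
    then show ?thesis using XP0 by simp
  next
    case (Suc K')
    have "(\<Sum>t<K. p t) = (\<Sum>t<K'. \<eta> (Suc t) * B (Suc t) * (cmod (P (Suc (Suc t))))\<^sup>2)"
      by (simp add: p_def Suc)
    also have "\<dots> \<le> XP" unfolding XP_def Suc sum.lessThan_Suc_shift
      by (simp add: Bnn \<eta>)
    finally show ?thesis .
  qed
  \<comment> \<open>The surplus term at scale \<open>K\<close> is bounded by the final term
    \<open>B K * (cmod (H K))^2\<close> of the prefix identity.\<close>
  have sum_h: "(\<Sum>t<K. h t) \<le> XH + 2 * b K"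
  proof -
    have "(\<Sum>t<K. h t) + \<eta> 0 * B 0 * (cmod (H 0))\<^sup>2 = (\<Sum>t<Suc K. \<eta> t * B t * (cmod (H t))\<^sup>2)"
      unfolding sum.lessThan_Suc_shift h_def by simp
    also have "\<dots> = XH + \<eta> K * B K * (cmod (H K))\<^sup>2" by (simp add: XH_def)
    also have "\<eta> K * B K * (cmod (H K))\<^sup>2 \<le> 2 * (B K * (cmod (H K))\<^sup>2)" by (rule \<eta>B) simp
    also have "\<dots> \<le> 2 * b K" using bLH by simp
    finally have "(\<Sum>t<K. h t) + \<eta> 0 * B 0 * (cmod (H 0))\<^sup>2 \<le> XH + 2 * b K" by simp
    moreover have "0 \<le> \<eta> 0 * B 0 * (cmod (H 0))\<^sup>2" by (simp add: \<eta> B0)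
    ultimately show ?thesis by linarith
  qed
  \<comment> \<open>The shifted sum returns 5/9 of \<open>XP\<close>, which is absorbed on the left.
    Dividing by the remaining 4/9 and rounding up gives the 3 and 15 in \<open>A\<close>, with room
    for the extra \<open>10/9 * b K\<close> in the bound for \<open>XH\<close>.\<close>
  have "XP \<le> (\<Sum>t<K. \<kappa> * (B t * (\<beta> t - (cmod (s t))\<^sup>2) * (cmod (P (Suc t)))\<^sup>2) + 5/9 * p t + 5 * (B (Suc t) * (cmod (g (Suc t)))\<^sup>2))"
    unfolding XP_def by (intro sum_mono termP) auto
  also have "\<dots> = \<kappa> * LP + 5/9 * (\<Sum>t<K. p t) + 5 * (\<Sum>t<K. B (Suc t) * (cmod (g (Suc t)))\<^sup>2)"
    by (simp add: LP_def sum.distrib sum_distrib_left)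
  also have "\<dots> \<le> \<kappa> * LP + 5/9 * XP + 5 * N K" using sum_p NS by simp
  finally have XP1: "4/9 * XP \<le> \<kappa> * LP + 5 * N K" by simp
  have "XH \<le> (\<Sum>t<K. \<kappa> * (B t * (1 - \<beta> t) * (cmod (H t))\<^sup>2) + 5/9 * h t + 5 * (B (Suc t) * (cmod (g (Suc t)))\<^sup>2))"
    unfolding XH_def by (intro sum_mono termH)
  also have "\<dots> = \<kappa> * LH + 5/9 * (\<Sum>t<K. h t) + 5 * (\<Sum>t<K. B (Suc t) * (cmod (g (Suc t)))\<^sup>2)"
    by (simp add: LH_def sum.distrib sum_distrib_left)
  also have "\<dots> \<le> \<kappa> * b K + (5/9 * XH + 10/9 * b K) + 5 * N K"
  proof -
    have "5/9 * (\<Sum>t<K. h t) \<le> 5/9 * XH + 10/9 * b K" using sum_h by simp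
    then show ?thesis using NS bLH \<kappa> by (intro add_mono mult_left_mono) auto
  qed
  finally have XH1: "4/9 * XH \<le> \<kappa> * b K + 10/9 * b K + 5 * N K" by simp
  have b0: "0 \<le> b K" using bLH LH0 by simp
  have a0: "0 \<le> a" using aLP LP0 by simp
  have A: "A = 3 * \<kappa> + 15" by (simp add: A_def \<kappa>_def)
  have Apos: "A > 0" using \<kappa> by (simp add: A)
  have XP2: "XP \<le> A * (a + N K)"
  proof -
    have "\<kappa> * LP \<le> \<kappa> * a" using \<kappa> aLP by simp
    moreover have "0 \<le> \<kappa> * a" "0 \<le> \<kappa> * N K" using \<kappa> a0 N0 by auto
    moreover have "A * (a + N K) = 3 * (\<kappa> * a) + 3 * (\<kappa> * N K) + 15 * a + 15 * N K"
      by (simp add: A algebra_simps)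
    ultimately show ?thesis using XP1 a0 N0 by linarith
  qed
  have XH2: "XH \<le> A * (b K + N K)"
  proof -
    have "0 \<le> \<kappa> * b K" "0 \<le> \<kappa> * N K" using \<kappa> b0 N0 by auto
    moreover have "A * (b K + N K) = 3 * (\<kappa> * b K) + 3 * (\<kappa> * N K) + 15 * b K + 15 * N K"
      by (simp add: A algebra_simps)
    ultimately show ?thesis using XH1 b0 N0 by linarith
  qed
  \<comment> \<open>Chosen so that \<open>c1 * \<epsilon> * A = 1/2\<close>: half of
    \<open>a\<close> reappears on the right and is absorbed.\<close>
  define \<epsilon> where "\<epsilon> = 1 / (2 * c1 * A)"
  have \<epsilon>: "\<epsilon> > 0" using c Apos by (simp add: \<epsilon>_def)
  have cross: "2 * (B t * Re ((cnj (s t) - of_real (\<beta> t)) * P (Suc t) * cnj (H t)))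
      \<le> c1 * \<epsilon> * (\<eta> t * B t * (cmod (P (Suc t)))\<^sup>2) + c1 / \<epsilon> * (\<eta> t * B t * (cmod (H t))\<^sup>2)" for t
  proof -
    have "Re ((cnj (s t) - of_real (\<beta> t)) * P (Suc t) * cnj (H t)) \<le> cmod (cnj (s t) - of_real (\<beta> t)) * (cmod (P (Suc t)) * cmod (H t))"
      using complex_Re_le_cmod[of "(cnj (s t) - of_real (\<beta> t)) * P (Suc t) * cnj (H t)"]
      by (simp add: norm_mult mult.assoc)
    also have "\<dots> \<le> c1 * \<eta> t * (cmod (P (Suc t)) * cmod (H t))"
      by (intro mult_right_mono s\<beta>) auto
    finally have "B t * Re ((cnj (s t) - of_real (\<beta> t)) * P (Suc t) * cnj (H t))
        \<le> B t * (c1 * \<eta> t * (cmod (P (Suc t)) * cmod (H t)))"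
      using Bnn by (rule mult_left_mono)
    moreover have "2 * (B t * (c1 * \<eta> t * (cmod (P (Suc t)) * cmod (H t))))
        = c1 * (\<eta> t * B t) * (2 * (cmod (P (Suc t)) * cmod (H t)))" by simp
    ultimately have 1: "2 * (B t * Re ((cnj (s t) - of_real (\<beta> t)) * P (Suc t) * cnj (H t)))
       \<le> c1 * (\<eta> t * B t) * (2 * (cmod (P (Suc t)) * cmod (H t)))" by linarith
    have 2: "2 * (x * y) \<le> \<epsilon> * x\<^sup>2 + 1 / \<epsilon> * y\<^sup>2" for x y :: real
    proof -
      have "0 \<le> \<epsilon> * (x - y / \<epsilon>)\<^sup>2" using \<epsilon> by simp
      also have "\<dots> = \<epsilon> * x\<^sup>2 + 1 / \<epsilon> * y\<^sup>2 - 2 * (x * y)"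
        using \<epsilon> by (simp add: power2_eq_square field_simps)
      finally show ?thesis by simp
    qed
    have "c1 * (\<eta> t * B t) * (2 * (cmod (P (Suc t)) * cmod (H t))) \<le> c1 * (\<eta> t * B t) * (\<epsilon> * (cmod (P (Suc t)))\<^sup>2 + 1 / \<epsilon> * (cmod (H t))\<^sup>2)"
      by (intro mult_left_mono 2 mult_nonneg_nonneg Bnn \<eta>) (use c in auto)
    also have "\<dots> = c1 * \<epsilon> * (\<eta> t * B t * (cmod (P (Suc t)))\<^sup>2) + c1 / \<epsilon> * (\<eta> t * B t * (cmod (H t))\<^sup>2)"
      by (simp add: algebra_simps)
    finally show ?thesis using 1 by linarith
  qed
  have "a - b K = 2 * (\<Sum>t<K. B t * Re ((cnj (s t) - of_real (\<beta> t)) * P (Suc t) * cnj (H t)))"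
    unfolding a_def b_def using energy_difference[of H g K P s B \<beta>, OF H0 HS PS PK BS] by simp
  also have "\<dots> \<le> (\<Sum>t<K. c1 * \<epsilon> * (\<eta> t * B t * (cmod (P (Suc t)))\<^sup>2) + c1 / \<epsilon> * (\<eta> t * B t * (cmod (H t))\<^sup>2))"
    unfolding sum_distrib_left by (intro sum_mono cross)
  also have "\<dots> = c1 * \<epsilon> * XP + c1 / \<epsilon> * XH"
    by (simp add: XP_def XH_def sum.distrib sum_distrib_left)
  also have "\<dots> \<le> c1 * \<epsilon> * (A * (a + N K)) + c1 / \<epsilon> * (A * (b K + N K))"
    using c \<epsilon> by (intro add_mono mult_left_mono XP2 XH2) auto
  also have "c1 * \<epsilon> * (A * (a + N K)) = 1/2 * (a + N K)"
    using c Apos by (simp add: \<epsilon>_def)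
  also have "c1 / \<epsilon> * (A * (b K + N K)) = 2 * c1\<^sup>2 * A\<^sup>2 * (b K + N K)"
    by (simp add: \<epsilon>_def power2_eq_square)
  finally have fin: "a - b K \<le> 1/2 * (a + N K) + 2 * c1\<^sup>2 * A\<^sup>2 * (b K + N K)" .
  define Y where "Y = c1\<^sup>2 * A\<^sup>2 * (b K + N K)"
  have "a - b K \<le> (1/2 * a + 1/2 * N K) + 2 * Y"
    using fin by (simp add: Y_def mult.assoc add_divide_distrib)
  then have "a \<le> 2 * b K + N K + 4 * Y" by simp
  also have "\<dots> = 2 * b K + N K + 4 * c1\<^sup>2 * A\<^sup>2 * (b K + N K)" by (simp add: Y_def)
  also have "\<dots> \<le> (2 + 4 * c1\<^sup>2 * A\<^sup>2) * (b K + N K)" using N0 by (simp add: algebra_simps)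
  finally show ?thesis using a_eq LP0 by linarith
qed

section \<open>Digit symbols\<close>

text \<open>Bezout made quantitative: on the unit circle
  \<open>norm (1 - w^k) \<le> k * norm (1 - w)\<close>, so writing the gcd as a combination of
  digits bounds its character by those of the digits. The induction adjoins one digit at a
  time.\<close>

lemma Gcd_character_gap:
  fixes D :: "nat set"
  assumes "finite D"
  shows "\<exists>C>0. \<forall>z::complex. norm z = 1 \<longrightarrow> (norm (1 - z ^ Gcd D))\<^sup>2 \<le> C * (\<Sum>a\<in>D. (norm (1 - z ^ a))\<^sup>2)"
  using assms
proof (induction D)
  case empty
  then show ?case by (intro exI[of _ 1]) auto
next
  case (insert a D)
  then obtain C where C: "C > 0"
    "\<And>z::complex. norm z = 1 \<Longrightarrow> (norm (1 - z ^ Gcd D))\<^sup>2 \<le> C * (\<Sum>a\<in>D. (norm (1 - z ^ a))\<^sup>2)"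
    by blast
  show ?case
  proof (cases "a = 0")
    case True
    then show ?thesis using C insert.hyps by (intro exI[of _ C]) auto
  next
    case False
    \<comment> \<open>With natural coefficients and this choice of signs Bezout needs a nonzero
      \<open>a\<close>; adjoining the digit 0 does not change the gcd.\<close>
    then obtain x y where xy: "a * x = Gcd D * y + gcd a (Gcd D)"
      using bezout_nat[of a "Gcd D"] by blast
    define C' where "C' = 2 * (real x)\<^sup>2 + 2 * (real y)\<^sup>2 * C + 1"
    have C': "C' > 0" "2 * (real x)\<^sup>2 \<le> C'" "2 * (real y)\<^sup>2 * C \<le> C'"
      using C(1) by (auto simp: C'_def add_nonneg_pos)
    have "(norm (1 - z ^ Gcd (insert a D)))\<^sup>2 \<le> C' * (\<Sum>a\<in>insert a D. (norm (1 - z ^ a))\<^sup>2)" if z: "norm z = 1" for z :: complex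
    proof -
      let ?g = "Gcd D"
      have bound: "norm (1 - (z ^ n) ^ k) \<le> real k * norm (1 - z ^ n)" for n k
        using norm_power_diff[of 1 "z ^ n" k] z by (simp add: norm_power)
      have "z ^ (?g * y) * (1 - z ^ gcd a ?g) = (1 - (z ^ a) ^ x) - (1 - (z ^ ?g) ^ y)"
        by (simp add: power_mult[symmetric] xy algebra_simps power_add[symmetric])
      then have "norm (1 - z ^ gcd a ?g) = norm ((1 - (z ^ a) ^ x) - (1 - (z ^ ?g) ^ y))"
        using z by (metis mult_1 norm_mult norm_power power_one)
      also have "\<dots> \<le> norm (1 - (z ^ a) ^ x) + norm (1 - (z ^ ?g) ^ y)" by (rule norm_triangle_ineq4)
      also have "\<dots> \<le> real x * norm (1 - z ^ a) + real y * norm (1 - z ^ ?g)" by (intro add_mono bound)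
      finally have "(norm (1 - z ^ gcd a ?g))\<^sup>2 \<le> (real x * norm (1 - z ^ a) + real y * norm (1 - z ^ ?g))\<^sup>2"
        by (intro power_mono) auto
      also have "\<dots> \<le> 2 * (real x * norm (1 - z ^ a))\<^sup>2 + 2 * (real y * norm (1 - z ^ ?g))\<^sup>2"
        using sum_squares_bound[of "real x * norm (1 - z ^ a)" "real y * norm (1 - z ^ ?g)"]
        by (simp add: power2_sum)
      also have "\<dots> = 2 * (real x)\<^sup>2 * (norm (1 - z ^ a))\<^sup>2 + 2 * (real y)\<^sup>2 * (norm (1 - z ^ ?g))\<^sup>2"
        by (simp add: power_mult_distrib)
      also have "\<dots> \<le> 2 * (real x)\<^sup>2 * (norm (1 - z ^ a))\<^sup>2 + 2 * (real y)\<^sup>2 * (C * (\<Sum>a\<in>D. (norm (1 - z ^ a))\<^sup>2))"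
        by (intro add_left_mono mult_left_mono C z) auto
      also have "\<dots> \<le> C' * (norm (1 - z ^ a))\<^sup>2 + C' * (\<Sum>a\<in>D. (norm (1 - z ^ a))\<^sup>2)"
        using C' by (auto simp: mult.assoc[symmetric] intro!: add_mono mult_right_mono sum_nonneg)
      also have "\<dots> = C' * (\<Sum>a\<in>insert a D. (norm (1 - z ^ a))\<^sup>2)"
        using insert.hyps by (simp add: distrib_left)
      finally show ?thesis by simp
    qed
    then show ?thesis using C'(1) by blast
  qed
qed

definition digit_symbol :: "nat set \<Rightarrow> complex \<Rightarrow> complex" where
  "digit_symbol D z = (\<Sum>a\<in>D. z ^ a) / of_nat (card D)"

definition lazy_symbol :: "nat set \<Rightarrow> complex \<Rightarrow> real" where
  "lazy_symbol D z = (1 + (norm (digit_symbol D z))\<^sup>2) / 2"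

lemma norm_digit_symbol_le: "norm z = 1 \<Longrightarrow> norm (digit_symbol D z) \<le> 1"
proof -
  assume z: "norm z = 1"
  have "norm (\<Sum>a\<in>D. z ^ a) \<le> (\<Sum>a\<in>D. norm (z ^ a))" by (rule norm_sum)
  then have "norm (\<Sum>a\<in>D. z ^ a) \<le> real (card D)" using z by (simp add: norm_power)
  then show ?thesis unfolding digit_symbol_def norm_divide
    by (cases "card D = 0") (auto simp: divide_le_eq_1)
qed

text \<open>The sum of \<open>(norm (z^b - z^a))^2\<close> over all pairs of digits is
  \<open>2 * n^2 * (1 - |s|^2)\<close>, with \<open>n\<close> digits and digit symbol
  \<open>s\<close>. Only the pairs with \<open>b = 0\<close> are kept.\<close>

lemma digit_symbol_gap:
  assumes D: "finite D" "0 \<in> D" and z: "norm z = 1"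
  shows "(\<Sum>a\<in>D. (norm (1 - z ^ a))\<^sup>2) / (2 * (real (card D))\<^sup>2) \<le> 1 - (norm (digit_symbol D z))\<^sup>2"
proof -
  define n where "n = real (card D)"
  define S where "S = (\<Sum>a\<in>D. z ^ a)"
  have n: "n > 0" using D by (auto simp: n_def card_gt_0_iff)
  have sq: "(norm (x - y))\<^sup>2 = 2 - 2 * Re (x * cnj y)" if "norm x = 1" "norm y = 1" for x y :: complex
    using cmod_add_squared[of x "- y"] that by simp
  have "(\<Sum>a\<in>D. (norm (1 - z ^ a))\<^sup>2) = (\<Sum>b\<in>{0}. \<Sum>a\<in>D. (norm (z ^ b - z ^ a))\<^sup>2)" by simp
  also have "\<dots> \<le> (\<Sum>b\<in>D. \<Sum>a\<in>D. (norm (z ^ b - z ^ a))\<^sup>2)"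
    using D by (intro sum_mono2) (auto intro!: sum_nonneg)
  also have "\<dots> = (\<Sum>b\<in>D. \<Sum>a\<in>D. 2 - 2 * Re (z ^ b * cnj (z ^ a)))"
    using z by (intro sum.cong refl sq) (auto simp: norm_power)
  also have "\<dots> = 2 * n\<^sup>2 - 2 * Re (\<Sum>b\<in>D. \<Sum>a\<in>D. z ^ b * cnj (z ^ a))"
    by (simp add: sum_subtractf sum_distrib_left n_def power2_eq_square Re_sum)
  also have "(\<Sum>b\<in>D. \<Sum>a\<in>D. z ^ b * cnj (z ^ a)) = S * cnj S"
    by (simp add: S_def sum_product cnj_sum)
  also have "Re (S * cnj S) = (norm S)\<^sup>2"
    by (metis Re_complex_of_real complex_norm_square)
  finally have "(\<Sum>a\<in>D. (norm (1 - z ^ a))\<^sup>2) / (2 * n\<^sup>2) \<le> (2 * n\<^sup>2 - 2 * (norm S)\<^sup>2) / (2 * n\<^sup>2)"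
    by (rule divide_right_mono) simp
  also have "\<dots> = 1 - (norm S / n)\<^sup>2" using n by (simp add: field_simps)
  also have "norm S / n = norm (digit_symbol D z)"
    by (simp add: digit_symbol_def S_def n_def norm_divide)
  finally show ?thesis by (simp add: n_def)
qed

text \<open>Each digit is \<open>q * Gcd D\<close>, and for a nonzero digit
  \<open>q \<le> \<Sum>D\<close>, so every term of the average is Lipschitz in
  \<open>z ^ Gcd D\<close>. The added 1 keeps the constant positive.\<close>

lemma norm_one_minus_digit_symbol:
  assumes D: "finite D" "0 \<in> D" and z: "norm z = 1"
  shows "norm (1 - digit_symbol D z) \<le> (real (\<Sum>D) + 1) * norm (1 - z ^ Gcd D)"
proof -
  define \<eta> where "\<eta> = norm (1 - z ^ Gcd D)"
  have n: "card D > 0" using D by (auto simp: card_gt_0_iff)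
  have 1: "norm (1 - z ^ a) \<le> (real (\<Sum>D) + 1) * \<eta>" if a: "a \<in> D" for a
  proof (cases "a = 0")
    case False
    obtain q where q: "a = Gcd D * q" using a by (meson Gcd_dvd dvdE)
    have "q \<le> a" using q False by (cases "Gcd D = 0") (auto simp del: Gcd_0_iff)
    also have "a \<le> \<Sum>D" using D a member_le_sum[of a D "\<lambda>x. x"] by auto
    finally have "real q \<le> real (\<Sum>D) + 1" by linarith
    moreover have "norm (1 - z ^ a) \<le> real q * \<eta>"
      using norm_power_diff[of 1 "z ^ Gcd D" q] z by (simp add: q power_mult norm_power \<eta>_def)
    ultimately show ?thesis by (smt (verit) \<eta>_def mult_right_mono norm_ge_zero)
  qed (auto simp: \<eta>_def intro!: mult_nonneg_nonneg add_nonneg_nonneg sum_nonneg)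
  have "1 - digit_symbol D z = (\<Sum>a\<in>D. 1 - z ^ a) / of_nat (card D)"
    using n by (simp add: digit_symbol_def sum_subtractf field_simps)
  then have "norm (1 - digit_symbol D z) = norm (\<Sum>a\<in>D. 1 - z ^ a) / card D"
    by (simp add: norm_divide)
  also have "\<dots> \<le> (\<Sum>a\<in>D. (real (\<Sum>D) + 1) * \<eta>) / card D"
    by (intro divide_right_mono order_trans[OF norm_sum] sum_mono 1) auto
  also have "\<dots> = (real (\<Sum>D) + 1) * \<eta>" using n by simp
  finally show ?thesis by (simp add: \<eta>_def)
qed

text \<open>Factor \<open>1 - \<zeta>^d\<close> as \<open>1 - \<zeta>\<close> times a geometric sum.
  For \<open>\<zeta>\<close> this close to 1 the sum is within 1/2 of \<open>d\<close>, hence at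
  least 5/2 in modulus; here \<open>3 \<le> d\<close> enters.\<close>

lemma norm_one_minus_power_ge:
  fixes \<zeta> :: complex
  assumes d: "3 \<le> d" and \<zeta>: "norm \<zeta> = 1" and small: "norm (1 - \<zeta>) \<le> 1 / (2 * (real d)\<^sup>2)"
  shows "norm (1 - \<zeta>) \<le> 2/5 * norm (1 - \<zeta> ^ d)"
proof -
  have "of_nat d - (\<Sum>i<d. \<zeta> ^ i) = (\<Sum>i<d. 1 - \<zeta> ^ i)" by (simp add: sum_subtractf)
  then have "norm (of_nat d - (\<Sum>i<d. \<zeta> ^ i)) \<le> (\<Sum>i<d. norm (1 - \<zeta> ^ i))"
    by (metis norm_sum)
  also have "\<dots> \<le> (\<Sum>i<d. real d * norm (1 - \<zeta>))"
  proof (intro sum_mono)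
    fix i assume "i \<in> {..<d}"
    have "norm (1 - \<zeta> ^ i) \<le> real i * norm (1 - \<zeta>)" using norm_power_diff[of 1 \<zeta> i] \<zeta> by simp
    also have "\<dots> \<le> real d * norm (1 - \<zeta>)" using \<open>i \<in> {..<d}\<close> by (intro mult_right_mono) auto
    finally show "norm (1 - \<zeta> ^ i) \<le> real d * norm (1 - \<zeta>)" .
  qed
  also have "\<dots> = (real d)\<^sup>2 * norm (1 - \<zeta>)" by (simp add: power2_eq_square)
  also have "\<dots> \<le> (real d)\<^sup>2 * (1 / (2 * (real d)\<^sup>2))" by (intro mult_left_mono small) auto
  also have "\<dots> = 1/2" using d by simp
  finally have "norm (of_nat d - (\<Sum>i<d. \<zeta> ^ i)) \<le> 1/2" .
  moreover have "real d \<le> norm (of_nat d - (\<Sum>i<d. \<zeta> ^ i)) + norm (\<Sum>i<d. \<zeta> ^ i)"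
    using norm_triangle_sub[of "of_nat d" "\<Sum>i<d. \<zeta> ^ i"] by (simp add: add.commute)
  ultimately have "5/2 \<le> norm (\<Sum>i<d. \<zeta> ^ i)" using d by linarith
  then have "norm (1 - \<zeta>) * (5/2) \<le> norm (1 - \<zeta>) * norm (\<Sum>i<d. \<zeta> ^ i)" by (rule mult_left_mono) simp
  also have "\<dots> = norm (1 - \<zeta> ^ d)" by (simp add: one_diff_power_eq norm_mult)
  finally show ?thesis by simp
qed

lemma digit_symbol_constants:
  assumes d: "3 \<le> d" and D: "finite D" "0 \<in> D"
  obtains c0 c1 c2 :: real where "c0 > 0" "c1 > 0" "c2 > 0"
    "\<And>z. norm z = 1 \<Longrightarrow> norm (cnj (digit_symbol D z) - of_real (lazy_symbol D z)) \<le> c1 * norm (1 - z ^ Gcd D)"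
    "\<And>z. norm z = 1 \<Longrightarrow> c2 * (norm (1 - z ^ Gcd D))\<^sup>2 \<le> lazy_symbol D z - (norm (digit_symbol D z))\<^sup>2"
    "\<And>z. norm z = 1 \<Longrightarrow> c2 * (norm (1 - z ^ Gcd D))\<^sup>2 \<le> 1 - lazy_symbol D z"
    "\<And>z. norm z = 1 \<Longrightarrow> norm (1 - z ^ Gcd D) \<le> c0 \<Longrightarrow>
      norm (1 - z ^ Gcd D) \<le> 2/5 * norm (1 - (z ^ d) ^ Gcd D) \<and> 9/10 \<le> lazy_symbol D z"
proof -
  define \<Lambda> where "\<Lambda> = real (\<Sum>D) + 1"
  define n where "n = real (card D)"
  have n: "n > 0" using D by (auto simp: n_def card_gt_0_iff)
  have \<Lambda>: "\<Lambda> > 0" unfolding \<Lambda>_def by linarith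
  obtain C where C: "C > 0"
    "\<And>z::complex. norm z = 1 \<Longrightarrow> (norm (1 - z ^ Gcd D))\<^sup>2 \<le> C * (\<Sum>a\<in>D. (norm (1 - z ^ a))\<^sup>2)"
    using Gcd_character_gap[OF D(1)] by blast
  \<comment> \<open>In \<open>c2\<close>, the factor \<open>2 * n^2\<close> comes from the digit
    gap, \<open>C\<close> from the gcd bound, and a further 2 from halving \<open>1 - |s|^2\<close>
    at the midpoint. In \<open>c0\<close>, the first bound gives the growth under
    \<open>d\<close>-th powers and the second gives
    \<open>1 - lazy_symbol D z \<le> 1/10\<close>.\<close>
  define c2 where "c2 = 1 / (4 * n\<^sup>2 * C)"
  define c0 where "c0 = min (1 / (2 * (real d)\<^sup>2)) (1 / (10 * \<Lambda>))"
  have gap: "2 * (c2 * (norm (1 - z ^ Gcd D))\<^sup>2) \<le> 1 - (norm (digit_symbol D z))\<^sup>2" if z: "norm z = 1" for z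
  proof -
    have "c2 * (norm (1 - z ^ Gcd D))\<^sup>2 \<le> c2 * (C * (\<Sum>a\<in>D. (norm (1 - z ^ a))\<^sup>2))"
      using C z by (intro mult_left_mono) (auto simp: c2_def)
    also have "2 * \<dots> = (\<Sum>a\<in>D. (norm (1 - z ^ a))\<^sup>2) / (2 * n\<^sup>2)"
      using C n by (simp add: c2_def)
    also have "\<dots> \<le> 1 - (norm (digit_symbol D z))\<^sup>2"
      using digit_symbol_gap[OF D z] by (simp add: n_def)
    finally show ?thesis by simp
  qed
  have lazy: "1 - lazy_symbol D z \<le> \<Lambda> * norm (1 - z ^ Gcd D)" if z: "norm z = 1" for z
  proof -
    let ?s = "norm (digit_symbol D z)"
    have "1 - lazy_symbol D z = (1 - ?s) * ((1 + ?s) / 2)"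
      by (simp add: lazy_symbol_def power2_eq_square algebra_simps diff_divide_distrib add_divide_distrib)
    also have "\<dots> \<le> (1 - ?s) * 1"
      using norm_digit_symbol_le[OF z, of D] by (intro mult_left_mono) auto
    also have "\<dots> \<le> norm (1 - digit_symbol D z)"
      using norm_triangle_ineq2[of 1 "digit_symbol D z"] by simp
    also have "\<dots> \<le> \<Lambda> * norm (1 - z ^ Gcd D)"
      unfolding \<Lambda>_def by (rule norm_one_minus_digit_symbol[OF D z])
    finally show ?thesis .
  qed
  show thesis
  proof (rule that[of c0 "2 * \<Lambda>" c2])
    show "c0 > 0" "2 * \<Lambda> > 0" "c2 > 0" using d \<Lambda> n C by (auto simp: c0_def c2_def)
    fix z :: complex assume z: "norm z = 1"
    have "cnj (digit_symbol D z) - of_real (lazy_symbol D z) = of_real (1 - lazy_symbol D z) - cnj (1 - digit_symbol D z)"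
      by simp
    then have "norm (cnj (digit_symbol D z) - of_real (lazy_symbol D z))
        \<le> norm (of_real (1 - lazy_symbol D z) :: complex) + norm (cnj (1 - digit_symbol D z))"
      by (metis norm_triangle_ineq4)
    also have "norm (of_real (1 - lazy_symbol D z) :: complex) = 1 - lazy_symbol D z"
      using norm_digit_symbol_le[OF z, of D] unfolding norm_of_real
      by (intro abs_of_nonneg) (simp add: lazy_symbol_def power_le_one)
    also have "norm (cnj (1 - digit_symbol D z)) \<le> \<Lambda> * norm (1 - z ^ Gcd D)"
      unfolding complex_mod_cnj \<Lambda>_def by (rule norm_one_minus_digit_symbol[OF D z])
    finally show "norm (cnj (digit_symbol D z) - of_real (lazy_symbol D z)) \<le> 2 * \<Lambda> * norm (1 - z ^ Gcd D)"
      using lazy[OF z] by simp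
    show "c2 * (norm (1 - z ^ Gcd D))\<^sup>2 \<le> lazy_symbol D z - (norm (digit_symbol D z))\<^sup>2"
      "c2 * (norm (1 - z ^ Gcd D))\<^sup>2 \<le> 1 - lazy_symbol D z"
      using gap[OF z] by (auto simp: lazy_symbol_def field_simps)
    assume small: "norm (1 - z ^ Gcd D) \<le> c0"
    have "norm (1 - z ^ Gcd D) \<le> 2/5 * norm (1 - (z ^ Gcd D) ^ d)"
      using small z by (intro norm_one_minus_power_ge d) (auto simp: c0_def norm_power)
    moreover have "\<Lambda> * norm (1 - z ^ Gcd D) \<le> \<Lambda> * (1 / (10 * \<Lambda>))"
      using small \<Lambda> by (intro mult_left_mono) (auto simp: c0_def)
    ultimately show "norm (1 - z ^ Gcd D) \<le> 2/5 * norm (1 - (z ^ d) ^ Gcd D) \<and> 9/10 \<le> lazy_symbol D z"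
      using lazy[OF z] \<Lambda> by (simp add: power_mult[symmetric] mult.commute)
  qed
qed

section \<open>The maximal inequality for periodic functions\<close>

definition dft :: "nat \<Rightarrow> (int \<Rightarrow> real) \<Rightarrow> nat \<Rightarrow> complex" where
  "dft M f m = (\<Sum>n\<in>{0..<int M}. of_real (f n) * cis (2 * pi * real m * of_int n / real M))"

definition periodic :: "nat \<Rightarrow> (int \<Rightarrow> 'a) \<Rightarrow> bool" where
  "periodic M f \<longleftrightarrow> (\<forall>n. f (n + int M) = f n)"

lemma periodic_mult: "periodic M f \<Longrightarrow> f (n + k * int M) = f n"
proof (induction k rule: int_induct[where k=0])
  case (step1 i)
  have "f (n + (i + 1) * int M) = f ((n + i * int M) + int M)" by (simp add: algebra_simps)
  then show ?case using step1 by (simp add: periodic_def)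
next
  case (step2 i)
  have "f (n + i * int M) = f ((n + (i - 1) * int M) + int M)" by (simp add: algebra_simps)
  then show ?case using step2 by (simp add: periodic_def)
qed simp

lemma periodic_mod: "periodic M f \<Longrightarrow> f (n mod int M) = f n"
  using periodic_mult[of M f "n mod int M" "n div int M"] by simp

lemma periodic_sum_shift:
  assumes M: "M > 0" and f: "periodic M f"
  shows "(\<Sum>n\<in>{0..<int M}. f (n + c)) = (\<Sum>n\<in>{0..<int M}. f n)"
proof -
  have inj: "inj_on (\<lambda>n. (n + c) mod int M) {0..<int M}"
  proof (rule inj_onI)
    fix x y assume "x \<in> {0..<int M}" "y \<in> {0..<int M}" and eq: "(x + c) mod int M = (y + c) mod int M"
    have "(x + c - c) mod int M = (y + c - c) mod int M" by (rule mod_diff_cong[OF eq refl])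
    then show "x = y" using \<open>x \<in> {0..<int M}\<close> \<open>y \<in> {0..<int M}\<close> by simp
  qed
  moreover have "(\<lambda>n. (n + c) mod int M) ` {0..<int M} = {0..<int M}"
    using M by (intro endo_inj_surj inj) auto
  ultimately have bij: "bij_betw (\<lambda>n. (n + c) mod int M) {0..<int M} {0..<int M}"
    by (simp add: bij_betw_def)
  have "(\<Sum>n\<in>{0..<int M}. f (n + c)) = (\<Sum>n\<in>{0..<int M}. f ((n + c) mod int M))"
    by (simp add: periodic_mod[OF f])
  also have "\<dots> = (\<Sum>n\<in>{0..<int M}. f n)"
    by (rule sum.reindex_bij_betw[OF bij])
  finally show ?thesis .
qed

text \<open>The positive sign in the exponent of \<open>dft\<close> makes a shift to the right a
  multiplication by a positive power of the root of unity, so the digit symbols appear without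
  conjugation and their adjoints with it.\<close>

lemma dft_shift:
  assumes M: "M > 0" and f: "periodic M f"
  shows "dft M (\<lambda>n. f (n - c)) m = cis (2 * pi * real m * of_int c / real M) * dft M f m"
proof -
  define h where "h = (\<lambda>n. of_real (f n) * cis (2 * pi * real m * of_int n / real M))"
  have per: "periodic M h"
    unfolding periodic_def
  proof
    fix n
    have "2 * pi * real m * of_int (n + int M) / real M = 2 * pi * real m * of_int n / real M + 2 * pi * of_nat m"
      using M by (simp add: field_simps)
    then have "cis (2 * pi * real m * of_int (n + int M) / real M) = cis (2 * pi * real m * of_int n / real M)"
      by (simp add: cis_mult[symmetric] del: of_int_add)
    then show "h (n + int M) = h n" using f by (simp add: h_def periodic_def)
  qed
  have "of_real (f (n - c)) * cis (2 * pi * real m * of_int n / real M)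
      = cis (2 * pi * real m * of_int c / real M) * h (n - c)" for n
  proof -
    have "2 * pi * real m * of_int n / real M = 2 * pi * real m * of_int c / real M + 2 * pi * real m * of_int (n - c) / real M"
      by (simp add: add_divide_distrib[symmetric] algebra_simps)
    then show ?thesis by (simp add: h_def cis_mult[symmetric] mult_ac)
  qed
  then have "dft M (\<lambda>n. f (n - c)) m = cis (2 * pi * real m * of_int c / real M) * (\<Sum>n\<in>{0..<int M}. h (n + (- c)))"
    by (simp add: dft_def sum_distrib_left)
  also have "(\<Sum>n\<in>{0..<int M}. h (n + (- c))) = dft M f m"
    unfolding periodic_sum_shift[OF M per] by (simp add: h_def dft_def)
  finally show ?thesis .
qed

lemma sum_roots_of_unity:
  fixes k :: int
  assumes M: "M > 0" and k: "\<bar>k\<bar> < int M"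
  shows "(\<Sum>m<M. cis (2 * pi * real m * of_int k / real M)) = (if k = 0 then of_nat M else 0)"
proof (cases "k = 0")
  case False
  define w where "w = cis (2 * pi * of_int k / real M)"
  have pow: "cis (2 * pi * real m * of_int k / real M) = w ^ m" for m
    unfolding w_def Complex.DeMoivre by (rule arg_cong[where f=cis]) simp
  have "w ^ M = 1"
  proof -
    have "w ^ M = cis (2 * pi * of_int k)" using M by (simp add: w_def Complex.DeMoivre)
    then show ?thesis by (simp add: cis_multiple_2pi)
  qed
  moreover have "w \<noteq> 1"
  proof
    assume "w = 1"
    then have "Re w = 1" by simp
    then have "cos (2 * pi * of_int k / real M) = 1" unfolding w_def by simp
    then obtain j :: int where "2 * pi * of_int k / real M = of_int j * 2 * pi"
      by (auto simp: cos_one_2pi_int)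
    then have "real_of_int k = of_int j * real M" using M by (simp add: field_simps)
    then have "k = j * int M" by (metis of_int_eq_iff of_int_mult of_int_of_nat_eq)
    then show False using k False by (auto simp: abs_mult)
  qed
  ultimately show ?thesis using False by (simp add: pow geometric_sum sum_gp_strict)
qed simp

lemma dft_Parseval:
  assumes M: "M > 0"
  shows "(\<Sum>m<M. dft M f m * cnj (dft M g m)) = of_nat M * of_real (\<Sum>n\<in>{0..<int M}. f n * g n)"
proof -
  have "dft M f m * cnj (dft M g m)
      = (\<Sum>n\<in>{0..<int M}. \<Sum>n'\<in>{0..<int M}. of_real (f n * g n') * cis (2 * pi * real m * of_int (n - n') / real M))" for m
    unfolding dft_def cnj_sum sum_product
    by (intro sum.cong refl) (simp add: cis_cnj cis_mult diff_divide_distrib right_diff_distrib mult_ac)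
  then have "(\<Sum>m<M. dft M f m * cnj (dft M g m))
      = (\<Sum>m<M. \<Sum>n\<in>{0..<int M}. \<Sum>n'\<in>{0..<int M}. of_real (f n * g n') * cis (2 * pi * real m * of_int (n - n') / real M))"
    by simp
  also have "\<dots> = (\<Sum>n\<in>{0..<int M}. \<Sum>m<M. \<Sum>n'\<in>{0..<int M}. of_real (f n * g n') * cis (2 * pi * real m * of_int (n - n') / real M))"
    by (rule sum.swap)
  also have "\<dots> = (\<Sum>n\<in>{0..<int M}. \<Sum>n'\<in>{0..<int M}. of_real (f n * g n') * (\<Sum>m<M. cis (2 * pi * real m * of_int (n - n') / real M)))"
    unfolding sum_distrib_left by (intro sum.cong refl sum.swap)
  also have "\<dots> = (\<Sum>n\<in>{0..<int M}. \<Sum>n'\<in>{0..<int M}. of_real (f n * g n') * (if n = n' then of_nat M else 0))"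
    using M by (intro sum.cong refl) (subst sum_roots_of_unity, auto)
  also have "\<dots> = of_nat M * of_real (\<Sum>n\<in>{0..<int M}. f n * g n)"
    by (simp add: if_distrib sum.delta' sum_distrib_left mult_ac cong: if_cong)
  finally show ?thesis .
qed

lemma dft_norm_squared:
  assumes "M > 0"
  shows "(\<Sum>m<M. (norm (dft M f m))\<^sup>2) = real M * (\<Sum>n\<in>{0..<int M}. (f n)\<^sup>2)"
proof -
  have "complex_of_real (\<Sum>m<M. (norm (dft M f m))\<^sup>2) = of_real (real M * (\<Sum>n\<in>{0..<int M}. (f n)\<^sup>2))"
    unfolding of_real_sum complex_norm_square dft_Parseval[OF assms] by (simp add: power2_eq_square)
  then show ?thesis by (simp only: of_real_eq_iff)
qed

lemma dft_sum: "dft M (\<lambda>n. \<Sum>i\<in>I. f i n) m = (\<Sum>i\<in>I. dft M (f i) m)"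
  unfolding dft_def of_real_sum sum_distrib_right by (rule sum.swap)

lemma dft_cmult: "dft M (\<lambda>n. c * f n) m = of_real c * dft M f m"
  by (simp add: dft_def sum_distrib_left mult_ac)

lemma dft_add: "dft M (\<lambda>n. f n + g n) m = dft M f m + dft M g m"
  by (simp add: dft_def algebra_simps sum.distrib)

section \<open>Digit averages, lazy averages and their multipliers\<close>

definition digit_avg :: "nat set \<Rightarrow> nat \<Rightarrow> (int \<Rightarrow> real) \<Rightarrow> int \<Rightarrow> real" where
  "digit_avg D h f n = 1 / real (card D) * (\<Sum>a\<in>D. f (n - int (a * h)))"

text \<open>A step of the walk that stays put with probability 1/2 and otherwise moves by
  \<open>h\<close> times the difference of two independent digits. Symmetrizing the digit turns its
  symbol \<open>s\<close> into \<open>|s|^2\<close>.\<close>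

definition lazy_avg :: "nat set \<Rightarrow> nat \<Rightarrow> (int \<Rightarrow> real) \<Rightarrow> int \<Rightarrow> real" where
  "lazy_avg D h f n = 1/2 * (f n + 1 / (real (card D))\<^sup>2 * (\<Sum>a\<in>D. \<Sum>b\<in>D. f (n - (int (a * h) - int (b * h)))))"

text \<open>\<open>N\<close> steps average over all integers with \<open>N\<close>
  base-\<open>d\<close> digits in \<open>D\<close>, leading zeros included.\<close>

primrec digit_avgs :: "nat set \<Rightarrow> nat \<Rightarrow> nat \<Rightarrow> (int \<Rightarrow> real) \<Rightarrow> int \<Rightarrow> real" where
  "digit_avgs D d 0 f = f"
| "digit_avgs D d (Suc N) f = digit_avg D (d ^ N) (digit_avgs D d N f)"

primrec lazy_avgs :: "nat set \<Rightarrow> nat \<Rightarrow> nat \<Rightarrow> (int \<Rightarrow> real) \<Rightarrow> int \<Rightarrow> real" where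
  "lazy_avgs D d 0 f = f"
| "lazy_avgs D d (Suc N) f = lazy_avg D (d ^ N) (lazy_avgs D d N f)"

lemma periodic_shift: "periodic M f \<Longrightarrow> periodic M (\<lambda>n. f (n - c))"
  by (simp add: periodic_def diff_add_eq[symmetric])

lemma periodic_digit_avg: "periodic M f \<Longrightarrow> periodic M (digit_avg D h f)"
  using periodic_shift[of M f] by (simp add: periodic_def digit_avg_def)

lemma periodic_lazy_avg: "periodic M f \<Longrightarrow> periodic M (lazy_avg D h f)"
  using periodic_shift[of M f] by (simp only: periodic_def lazy_avg_def simp_thms)

lemma periodic_digit_avgs: "periodic M f \<Longrightarrow> periodic M (digit_avgs D d N f)"
  by (induction N) (auto intro: periodic_digit_avg)

lemma periodic_lazy_avgs: "periodic M f \<Longrightarrow> periodic M (lazy_avgs D d N f)"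
  by (induction N) (auto intro: periodic_lazy_avg)

lemma digit_avgs_nonneg: "(\<And>n. 0 \<le> f n) \<Longrightarrow> 0 \<le> digit_avgs D d N f n"
  by (induction N arbitrary: n) (auto simp: digit_avg_def intro!: sum_nonneg divide_nonneg_nonneg)

lemma lazy_avgs_nonneg: "(\<And>n. 0 \<le> f n) \<Longrightarrow> 0 \<le> lazy_avgs D d N f n"
  by (induction N arbitrary: n) (auto simp: lazy_avg_def intro!: sum_nonneg divide_nonneg_nonneg add_nonneg_nonneg)

definition unit_root :: "nat \<Rightarrow> nat \<Rightarrow> complex" where
  "unit_root M m = cis (2 * pi * real m / real M)"

lemma norm_unit_root [simp]: "norm (unit_root M m) = 1"
  by (simp add: unit_root_def)

lemma unit_root_power_power:
  "(unit_root M m ^ h) ^ a = cis (2 * pi * real m * of_int (int (a * h)) / real M)"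
  unfolding unit_root_def Complex.DeMoivre by (rule arg_cong[where f=cis]) simp

lemma unit_root_shift:
  "cis (2 * pi * real m * of_int (int (a * h) - int (b * h)) / real M)
    = (unit_root M m ^ h) ^ a * cnj ((unit_root M m ^ h) ^ b)"
  unfolding unit_root_power_power cis_cnj cis_mult
  by (rule arg_cong[where f=cis]) (simp add: right_diff_distrib diff_divide_distrib)

lemma dft_digit_avg:
  assumes "M > 0" "periodic M f"
  shows "dft M (digit_avg D h f) m = digit_symbol D (unit_root M m ^ h) * dft M f m"
proof -
  have "dft M (digit_avg D h f) m = of_real (1 / real (card D)) * (\<Sum>a\<in>D. dft M (\<lambda>n. f (n - int (a * h))) m)"
    unfolding digit_avg_def[abs_def] dft_cmult dft_sum ..
  also have "\<dots> = of_real (1 / real (card D)) * (\<Sum>a\<in>D. (unit_root M m ^ h) ^ a * dft M f m)"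
    unfolding dft_shift[OF assms] unit_root_power_power ..
  finally show ?thesis
    by (simp add: digit_symbol_def sum_distrib_right)
qed

lemma dft_lazy_avg:
  assumes "M > 0" "periodic M f"
  shows "dft M (lazy_avg D h f) m = of_real (lazy_symbol D (unit_root M m ^ h)) * dft M f m"
proof -
  let ?z = "unit_root M m ^ h"
  have shift: "dft M (\<lambda>n. f (n - (int (a * h) - int (b * h)))) m = ?z ^ a * cnj (?z ^ b) * dft M f m" for a b
    unfolding dft_shift[OF assms] unit_root_shift ..
  have "dft M (lazy_avg D h f) m = of_real (1/2) * (dft M f m + of_real (1 / (real (card D))\<^sup>2) *
      (\<Sum>a\<in>D. \<Sum>b\<in>D. dft M (\<lambda>n. f (n - (int (a * h) - int (b * h)))) m))"
    unfolding lazy_avg_def[abs_def] dft_cmult dft_sum dft_add ..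
  also have "(\<Sum>a\<in>D. \<Sum>b\<in>D. dft M (\<lambda>n. f (n - (int (a * h) - int (b * h)))) m)
      = (\<Sum>a\<in>D. ?z ^ a) * cnj (\<Sum>b\<in>D. ?z ^ b) * dft M f m"
    unfolding shift cnj_sum sum_product unfolding sum_distrib_right ..
  also have "of_real (1/2) * (dft M f m + of_real (1 / (real (card D))\<^sup>2) * ((\<Sum>a\<in>D. ?z ^ a) * cnj (\<Sum>b\<in>D. ?z ^ b) * dft M f m))
     = ((1 + digit_symbol D ?z * cnj (digit_symbol D ?z)) / 2) * dft M f m"
    by (simp add: digit_symbol_def power2_eq_square algebra_simps add_divide_distrib)
  also have "(1 + digit_symbol D ?z * cnj (digit_symbol D ?z)) / 2 = of_real (lazy_symbol D ?z)"
    unfolding lazy_symbol_def of_real_divide of_real_add complex_norm_square by simp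
  finally show ?thesis .
qed

lemma dft_digit_avgs:
  assumes "M > 0" "periodic M f"
  shows "dft M (digit_avgs D d N f) m = (\<Prod>t<N. digit_symbol D (unit_root M m ^ (d ^ t))) * dft M f m"
  by (induction N) (simp_all add: dft_digit_avg assms periodic_digit_avgs mult_ac)

lemma dft_lazy_avgs:
  assumes "M > 0" "periodic M f"
  shows "dft M (lazy_avgs D d N f) m = of_real (\<Prod>t<N. lazy_symbol D (unit_root M m ^ (d ^ t))) * dft M f m"
  by (induction N) (simp_all add: dft_lazy_avg assms periodic_lazy_avgs mult_ac)

section \<open>The dual inequality and the discrete maximal inequality\<close>

lemma suffix_sum_recursion:
  fixes g s :: "nat \<Rightarrow> complex"
  assumes "t < K"
  shows "(\<Sum>N=t..K. (\<Prod>i=t..<N. s i) * g N) = g t + s t * (\<Sum>N=Suc t..K. (\<Prod>i=Suc t..<N. s i) * g N)"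
proof -
  have "(\<Sum>N=t..K. (\<Prod>i=t..<N. s i) * g N) = g t + (\<Sum>N=Suc t..K. (\<Prod>i=t..<N. s i) * g N)"
    using assms by (subst sum.atLeast_Suc_atMost) auto
  also have "(\<Sum>N=Suc t..K. (\<Prod>i=t..<N. s i) * g N) = (\<Sum>N=Suc t..K. s t * ((\<Prod>i=Suc t..<N. s i) * g N))"
    by (intro sum.cong refl) (simp add: prod.atLeast_Suc_lessThan)
  finally show ?thesis by (simp add: sum_distrib_left)
qed

lemma Re_mult_cnj_self: "Re (x * cnj x) = (norm x)\<^sup>2"
  by (metis Re_complex_of_real complex_norm_square)

lemma Re_complex_of_real_mult: "Re (of_real c * x) = c * Re x"
  by simp

text \<open>By Parseval the left side is, up to the factor \<open>M\<close>, the squared norm of the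
  sum of the adjoint averages applied to \<open>g N\<close>. Each character is handled by the energy
  comparison; the resulting form is then summed over all characters and read back on the integers,
  where nonnegativity of \<open>g\<close> and of the lazy kernels can be used.\<close>

lemma sum_of_averages_bound:
  fixes d :: nat
  assumes d: "3 \<le> d" and D: "finite D" "0 \<in> D"
  shows "\<exists>C>0. \<forall>K M g. M > 0 \<longrightarrow> (\<forall>N. periodic M (g N)) \<longrightarrow> (\<forall>N n. 0 \<le> g N n) \<longrightarrow>
      (\<Sum>m<M. (norm (\<Sum>N\<le>K. cnj (\<Prod>t<N. digit_symbol D (unit_root M m ^ (d ^ t))) * dft M (g N) m))\<^sup>2)
        \<le> C * real M * (\<Sum>n\<in>{0..<int M}. (\<Sum>N\<le>K. g N n)\<^sup>2)"
proof -
  obtain c0 c1 c2 :: real where c: "c0 > 0" "c1 > 0" "c2 > 0"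
    and s\<beta>: "\<And>z. norm z = 1 \<Longrightarrow> norm (cnj (digit_symbol D z) - of_real (lazy_symbol D z)) \<le> c1 * norm (1 - z ^ Gcd D)"
    and gap_s: "\<And>z. norm z = 1 \<Longrightarrow> c2 * (norm (1 - z ^ Gcd D))\<^sup>2 \<le> lazy_symbol D z - (norm (digit_symbol D z))\<^sup>2"
    and gap_\<beta>: "\<And>z. norm z = 1 \<Longrightarrow> c2 * (norm (1 - z ^ Gcd D))\<^sup>2 \<le> 1 - lazy_symbol D z"
    and lac: "\<And>z. norm z = 1 \<Longrightarrow> norm (1 - z ^ Gcd D) \<le> c0 \<Longrightarrow>
      norm (1 - z ^ Gcd D) \<le> 2/5 * norm (1 - (z ^ d) ^ Gcd D) \<and> 9/10 \<le> lazy_symbol D z"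
    using digit_symbol_constants[OF d D] by blast
  define C where "C = 2 + 4 * c1\<^sup>2 * (3 * (1 / (c0 * c2)) + 15)\<^sup>2"
  have C: "C > 0" by (simp add: C_def add_pos_nonneg)
  have claim: "(\<Sum>m<M. (norm (\<Sum>N\<le>K. cnj (\<Prod>t<N. digit_symbol D (unit_root M m ^ (d ^ t))) * dft M (g N) m))\<^sup>2)
        \<le> (C * 5) * real M * (\<Sum>n\<in>{0..<int M}. (\<Sum>N\<le>K. g N n)\<^sup>2)"
    if M: "M > 0" and per: "\<And>N. periodic M (g N)" and nn: "\<And>N n. 0 \<le> g N n"
    for K M and g :: "nat \<Rightarrow> int \<Rightarrow> real"
  proof -
    define z where "z = (\<lambda>m t. unit_root M m ^ (d ^ t))"
    define s where "s = (\<lambda>m t. digit_symbol D (z m t))"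
    define \<beta> where "\<beta> = (\<lambda>m t. lazy_symbol D (z m t))"
    define \<eta> where "\<eta> = (\<lambda>m t. norm (1 - z m t ^ Gcd D))"
    define B where "B = (\<lambda>m N. \<Prod>t<N. \<beta> m t)"
    define h where "h = (\<lambda>m N. dft M (g N) m)"
    define H where "H = (\<lambda>m N. \<Sum>j\<le>N. h m j)"
    define E where "E = (\<lambda>m. \<Sum>t\<le>K. B m t * (norm (h m t))\<^sup>2)"
    define b where "b = (\<lambda>m. E m + 2 * (\<Sum>t<K. B m (Suc t) * Re (H m t * cnj (h m (Suc t)))))"
    define G where "G = (\<lambda>n. \<Sum>N\<le>K. g N n)"
    define Z where "Z = (\<lambda>n. \<Sum>N\<le>K. lazy_avgs D d N (g N) n)"
    define S where "S = (\<Sum>n\<in>{0..<int M}. (G n)\<^sup>2)"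
    have z1: "norm (z m t) = 1" for m t by (simp add: z_def norm_power)
    have zS: "z m (Suc t) = z m t ^ d" for m t by (simp add: z_def power_mult[symmetric] mult.commute)
    have s1: "norm (s m t) \<le> 1" for m t by (simp add: s_def z1 norm_digit_symbol_le)
    have \<beta>01: "0 \<le> \<beta> m t" "\<beta> m t \<le> 1" for m t
      using norm_digit_symbol_le[OF z1, of D m t] by (auto simp: \<beta>_def lazy_symbol_def power_le_one)
    have \<eta>: "0 \<le> \<eta> m t" "\<eta> m t \<le> 2" for m t
      using norm_triangle_ineq4[of 1 "z m t ^ Gcd D"] by (auto simp: \<eta>_def z1 norm_power)
    have B0: "B m 0 = 1" and BS: "B m (Suc t) = \<beta> m t * B m t" for m t
      by (simp_all add: B_def)
    have Bnn: "0 \<le> B m t" for m t by (simp add: B_def prod_nonneg \<beta>01)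
    have B1: "B m t \<le> 1" for m t unfolding B_def using \<beta>01 by (intro prod_le_1) auto
    have H0: "H m 0 = h m 0" and HS: "H m (Suc t) = H m t + h m (Suc t)" for m t
      by (simp_all add: H_def)
    have E0: "0 \<le> E m" for m by (auto simp: E_def intro!: sum_nonneg mult_nonneg_nonneg Bnn)
    have main: "(norm (\<Sum>N\<le>K. cnj (\<Prod>t<N. s m t) * h m N))\<^sup>2 \<le> C * (b m + E m)" for m
    proof -
      define P where "P = (\<lambda>t. \<Sum>N=t..K. (\<Prod>i=t..<N. cnj (s m i)) * h m N)"
      have PS: "P t = h m t + cnj (s m t) * P (Suc t)" if "t < K" for t
        unfolding P_def by (rule suffix_sum_recursion[OF that])
      have PK: "P K = h m K" by (simp add: P_def)
      have "(norm (P 0))\<^sup>2 \<le> C * (b m + E m)"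
        unfolding C_def b_def E_def
      proof (rule lacunary_energy_comparison[of "H m" "h m" K P "s m" "B m" "\<beta> m" c0 c1 c2 "\<eta> m",
            OF H0 HS PS PK B0 BS c \<beta>01 s1 \<eta>])
        show "cmod (cnj (s m t) - complex_of_real (\<beta> m t)) \<le> c1 * \<eta> m t" for t
          using s\<beta>[OF z1] by (simp add: s_def \<beta>_def \<eta>_def)
        show "c2 * (\<eta> m t)\<^sup>2 \<le> \<beta> m t - (cmod (s m t))\<^sup>2" for t
          using gap_s[OF z1] by (simp add: s_def \<beta>_def \<eta>_def)
        show "c2 * (\<eta> m t)\<^sup>2 \<le> 1 - \<beta> m t" for t
          using gap_\<beta>[OF z1] by (simp add: \<beta>_def \<eta>_def)
        show "\<eta> m t \<le> 2 / 5 * \<eta> m (Suc t) \<and> 9 / 10 \<le> \<beta> m t" if "\<eta> m t \<le> c0" for t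
          using lac[OF z1] that by (simp add: \<beta>_def \<eta>_def zS)
      qed
      also have "P 0 = (\<Sum>N\<le>K. cnj (\<Prod>t<N. s m t) * h m N)"
        by (simp add: P_def atLeast0AtMost atLeast0LessThan)
      finally show ?thesis .
    qed
    \<comment> \<open>The suffix identity with \<open>s = \<beta>\<close>: the cross sums agree
      exactly, and the loss \<open>\<beta> - \<beta>^2\<close> is nonnegative and is
      dropped.\<close>
    have lazy: "(norm (dft M Z m))\<^sup>2 \<le> b m" for m
    proof -
      define s' where "s' = (\<lambda>t. complex_of_real (\<beta> m t))"
      define P where "P = (\<lambda>t. \<Sum>N=t..K. (\<Prod>i=t..<N. cnj (s' i)) * h m N)"
      have PS: "P t = h m t + cnj (s' t) * P (Suc t)" if "t < K" for t
        unfolding P_def by (rule suffix_sum_recursion[OF that])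
      have PK: "P K = h m K" by (simp add: P_def)
      have "P 0 = dft M Z m"
        by (simp add: P_def Z_def dft_sum dft_lazy_avgs[OF M per] s'_def \<beta>_def z_def h_def
            atLeast0AtMost atLeast0LessThan)
      moreover have "(\<Sum>t<K. B m t * Re (cnj (s' t) * P (Suc t) * cnj (h m t))) - (\<Sum>t<K. B m (Suc t) * Re (H m t * cnj (h m (Suc t)))) = 0"
        using energy_difference[of "H m" "h m" K P s' "B m" "\<beta> m", OF H0 HS PS PK BS] by (simp add: s'_def)
      moreover have "(cmod (P 0))\<^sup>2 + (\<Sum>t<K. B m t * (\<beta> m t - (cmod (s' t))\<^sup>2) * (cmod (P (Suc t)))\<^sup>2)
          = E m + 2 * (\<Sum>t<K. B m t * Re (cnj (s' t) * P (Suc t) * cnj (h m t)))"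
        unfolding E_def by (rule suffix_energy[of K P "h m" s' "B m" "\<beta> m", OF PS PK B0 BS])
      moreover have "0 \<le> (\<Sum>t<K. B m t * (\<beta> m t - (cmod (s' t))\<^sup>2) * (cmod (P (Suc t)))\<^sup>2)"
      proof (intro sum_nonneg mult_nonneg_nonneg Bnn)
        fix t show "0 \<le> \<beta> m t - (cmod (s' t))\<^sup>2"
          using \<beta>01[of m t] by (simp add: s'_def power2_eq_square mult_left_le_one_le)
      qed auto
      ultimately show ?thesis by (simp add: b_def)
    qed
    \<comment> \<open>Counting the diagonal \<open>E m\<close> twice instead of once turns the form
      into pairings of a lazily averaged piece with a full prefix sum, the shape that Parseval
      inverts.\<close>
    have b_le: "b m \<le> 2 * (\<Sum>t\<le>K. B m t * Re (h m t * cnj (H m t)))" for m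
    proof -
      have "(\<Sum>t\<le>k. B m t * Re (h m t * cnj (H m t)))
          = (\<Sum>t\<le>k. B m t * (norm (h m t))\<^sup>2) + (\<Sum>t<k. B m (Suc t) * Re (H m t * cnj (h m (Suc t))))" for k
      proof (induction k)
        case 0
        show ?case using Re_mult_cnj_self[of "h m 0"] by (simp add: H0 del: complex_cnj_mult)
      next
        case (Suc k)
        have "Re (h m (Suc k) * cnj (H m (Suc k))) = (norm (h m (Suc k)))\<^sup>2 + Re (H m k * cnj (h m (Suc k)))"
          unfolding HS Re_mult_cnj_self[symmetric] by (simp add: algebra_simps)
        then have "B m (Suc k) * Re (h m (Suc k) * cnj (H m (Suc k)))
            = B m (Suc k) * (norm (h m (Suc k)))\<^sup>2 + B m (Suc k) * Re (H m k * cnj (h m (Suc k)))"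
          by (simp only: distrib_left)
        with Suc.IH show ?case unfolding sum.atMost_Suc sum.lessThan_Suc by linarith
      qed
      from this[of K] show ?thesis using E0[of m] by (simp add: b_def E_def)
    qed
    have gG: "(\<Sum>j\<le>t. g j n) \<le> G n" if "t \<le> K" for t n
      unfolding G_def using that by (intro sum_mono2) (auto simp: nn)
    have G0: "0 \<le> G n" for n by (simp add: G_def sum_nonneg nn)
    \<comment> \<open>The monotonicity step: lazy averages of nonnegative pieces are nonnegative, so
      every prefix sum may be enlarged to \<open>G\<close>, and the sum over scales then closes up
      to \<open>Z\<close>.\<close>
    have sum_b: "(\<Sum>m<M. b m) \<le> 2 * real M * (\<Sum>n\<in>{0..<int M}. Z n * G n)"
    proof -
      have 1: "(\<Sum>m<M. B m t * Re (h m t * cnj (H m t)))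
          = real M * (\<Sum>n\<in>{0..<int M}. lazy_avgs D d t (g t) n * (\<Sum>j\<le>t. g j n))" for t
      proof -
        have "dft M (lazy_avgs D d t (g t)) m * cnj (dft M (\<lambda>n. \<Sum>j\<le>t. g j n) m)
            = of_real (B m t) * (h m t * cnj (H m t))" for m
          unfolding dft_lazy_avgs[OF M per] dft_sum B_def \<beta>_def z_def h_def H_def by (simp only: mult.assoc)
        then have "(\<Sum>m<M. B m t * Re (h m t * cnj (H m t)))
            = Re (\<Sum>m<M. dft M (lazy_avgs D d t (g t)) m * cnj (dft M (\<lambda>n. \<Sum>j\<le>t. g j n) m))"
          by (simp only: Re_sum Re_complex_of_real_mult)
        also have "\<dots> = real M * (\<Sum>n\<in>{0..<int M}. lazy_avgs D d t (g t) n * (\<Sum>j\<le>t. g j n))"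
          unfolding dft_Parseval[OF M] by simp
        finally show ?thesis .
      qed
      have "(\<Sum>m<M. b m) \<le> (\<Sum>m<M. 2 * (\<Sum>t\<le>K. B m t * Re (h m t * cnj (H m t))))"
        by (intro sum_mono b_le)
      also have "\<dots> = 2 * (\<Sum>t\<le>K. \<Sum>m<M. B m t * Re (h m t * cnj (H m t)))"
        unfolding sum_distrib_left[symmetric] by (subst sum.swap) simp
      also have "\<dots> = 2 * (\<Sum>t\<le>K. real M * (\<Sum>n\<in>{0..<int M}. lazy_avgs D d t (g t) n * (\<Sum>j\<le>t. g j n)))"
        unfolding 1 ..
      also have "\<dots> \<le> 2 * (\<Sum>t\<le>K. real M * (\<Sum>n\<in>{0..<int M}. lazy_avgs D d t (g t) n * G n))"
        by (intro mult_left_mono sum_mono gG) (auto intro!: lazy_avgs_nonneg nn)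
      also have "\<dots> = 2 * real M * (\<Sum>t\<le>K. \<Sum>n\<in>{0..<int M}. lazy_avgs D d t (g t) n * G n)"
        by (simp add: sum_distrib_left mult.assoc)
      also have "(\<Sum>t\<le>K. \<Sum>n\<in>{0..<int M}. lazy_avgs D d t (g t) n * G n) = (\<Sum>n\<in>{0..<int M}. Z n * G n)"
        by (subst sum.swap) (simp add: Z_def sum_distrib_right)
      finally show ?thesis .
    qed
    define W where "W = (\<Sum>m<M. b m)"
    have ZW: "real M * (\<Sum>n\<in>{0..<int M}. (Z n)\<^sup>2) \<le> W"
      unfolding W_def dft_norm_squared[OF M, symmetric] by (intro sum_mono lazy)
    have S0: "0 \<le> S" by (simp add: S_def sum_nonneg)
    have Z2: "0 \<le> (\<Sum>n\<in>{0..<int M}. (Z n)\<^sup>2)" by (simp add: sum_nonneg)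
    have ZG0: "0 \<le> (\<Sum>n\<in>{0..<int M}. Z n * G n)"
      by (auto simp: Z_def intro!: sum_nonneg mult_nonneg_nonneg G0 lazy_avgs_nonneg nn)
    have W0: "0 \<le> W" using ZW Z2 by (smt (verit) mult_nonneg_nonneg of_nat_0_le_iff)
    \<comment> \<open>A self-improving bound: \<open>W\<close> is at most \<open>2 * M\<close> times
      the pairing of \<open>Z\<close> with \<open>G\<close>, while \<open>M\<close> times the
      squared norm of \<open>Z\<close> is again at most \<open>W\<close>. Cauchy-Schwarz gives
      \<open>W^2 \<le> 4 * M * S * W\<close>.\<close>
    have W: "W \<le> 4 * real M * S"
    proof (cases "W = 0")
      case False
      have "W\<^sup>2 \<le> (2 * real M * (\<Sum>n\<in>{0..<int M}. Z n * G n))\<^sup>2"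
        using sum_b W0 unfolding W_def by (intro power_mono)
      also have "\<dots> = 4 * (real M)\<^sup>2 * (\<Sum>n\<in>{0..<int M}. Z n * G n)\<^sup>2"
        by (simp add: power_mult_distrib)
      also have "\<dots> \<le> 4 * (real M)\<^sup>2 * ((\<Sum>n\<in>{0..<int M}. (Z n)\<^sup>2) * S)"
        unfolding S_def by (intro mult_left_mono Cauchy_Schwarz_ineq_sum) auto
      also have "\<dots> = (4 * real M * S) * (real M * (\<Sum>n\<in>{0..<int M}. (Z n)\<^sup>2))"
        by (simp add: power2_eq_square)
      also have "\<dots> \<le> (4 * real M * S) * W"
        using S0 by (intro mult_left_mono ZW) auto
      finally have "W * W \<le> (4 * real M * S) * W" by (simp add: power2_eq_square)
      then show ?thesis using False W0 by simp
    qed (use S0 in auto)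
    have sum_E: "(\<Sum>m<M. E m) \<le> real M * S"
    proof -
      have "(\<Sum>m<M. E m) \<le> (\<Sum>m<M. \<Sum>t\<le>K. 1 * (norm (h m t))\<^sup>2)"
        unfolding E_def by (intro sum_mono mult_right_mono B1) auto
      also have "\<dots> = (\<Sum>t\<le>K. real M * (\<Sum>n\<in>{0..<int M}. (g t n)\<^sup>2))"
        by (subst sum.swap) (simp add: h_def dft_norm_squared[OF M])
      also have "\<dots> = real M * (\<Sum>n\<in>{0..<int M}. \<Sum>t\<le>K. (g t n)\<^sup>2)"
        by (subst sum.swap) (simp add: sum_distrib_left)
      also have "\<dots> \<le> real M * S"
      proof -
        have "(\<Sum>t\<le>K. (g t n)\<^sup>2) \<le> (G n)\<^sup>2" for n
        proof -
          have "(\<Sum>t\<le>K. (g t n)\<^sup>2) \<le> (\<Sum>t\<le>K. g t n * G n)"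
            unfolding power2_eq_square
          proof (intro sum_mono mult_left_mono nn)
            fix t assume "t \<in> {..K}"
            then show "g t n \<le> G n" unfolding G_def by (intro member_le_sum) (auto simp: nn)
          qed
          also have "\<dots> = (G n)\<^sup>2" by (simp add: G_def sum_distrib_right power2_eq_square)
          finally show ?thesis .
        qed
        then show ?thesis unfolding S_def by (intro mult_left_mono sum_mono) auto
      qed
      finally show ?thesis .
    qed
    have "(\<Sum>m<M. (norm (\<Sum>N\<le>K. cnj (\<Prod>t<N. s m t) * h m N))\<^sup>2) \<le> (\<Sum>m<M. C * (b m + E m))"
      by (intro sum_mono main)
    also have "\<dots> = C * (W + (\<Sum>m<M. E m))"
      by (simp add: W_def sum_distrib_left[symmetric] sum.distrib)
    also have "\<dots> \<le> C * (4 * real M * S + real M * S)"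
      using C by (intro mult_left_mono add_mono W sum_E) auto
    also have "\<dots> = (C * 5) * real M * S" by (simp add: algebra_simps)
    finally show ?thesis by (simp add: s_def z_def h_def S_def G_def)
  qed
  show ?thesis
  proof (intro exI conjI allI impI)
    show "C * 5 > 0" using C by simp
  qed (rule claim, auto)
qed

text \<open>Duality: splitting the maximal function according to the scale that attains it writes
  its squared norm as a pairing of \<open>f\<close> with the sum of adjoint averages. The bound for
  that sum contains the squared norm of the maximal function itself, which cancels against the left
  side.\<close>

lemma discrete_maximal_inequality:
  fixes d :: nat
  assumes d: "3 \<le> d" and D: "finite D" "0 \<in> D"
  shows "\<exists>C>0. \<forall>K M f. M > 0 \<longrightarrow> periodic M f \<longrightarrow> (\<forall>n. 0 \<le> f n) \<longrightarrow>
      (\<Sum>n\<in>{0..<int M}. (Max ((\<lambda>N. digit_avgs D d N f n) ` {..K}))\<^sup>2) \<le> C * (\<Sum>n\<in>{0..<int M}. (f n)\<^sup>2)"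
proof -
  obtain C where C: "C > 0"
    and bound: "\<And>K M g. M > 0 \<Longrightarrow> (\<And>N. periodic M (g N)) \<Longrightarrow> (\<And>N n. 0 \<le> g N n) \<Longrightarrow>
      (\<Sum>m<M. (norm (\<Sum>N\<le>K. cnj (\<Prod>t<N. digit_symbol D (unit_root M m ^ (d ^ t))) * dft M (g N) m))\<^sup>2)
        \<le> C * real M * (\<Sum>n\<in>{0..<int M}. (\<Sum>N\<le>K. g N n)\<^sup>2)"
    using sum_of_averages_bound[OF d D] by auto
  have claim: "(\<Sum>n\<in>{0..<int M}. (Max ((\<lambda>N. digit_avgs D d N f n) ` {..K}))\<^sup>2) \<le> C * (\<Sum>n\<in>{0..<int M}. (f n)\<^sup>2)"
    if M: "M > 0" and per: "periodic M f" and nn: "\<And>n. 0 \<le> f n" for K M and f :: "int \<Rightarrow> real"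
  proof -
    define A where "A = (\<lambda>N n. digit_avgs D d N f n)"
    define F where "F = (\<lambda>n. Max ((\<lambda>N. A N n) ` {..K}))"
    \<comment> \<open>Here \<open>\<nu>\<close> is the selected scale. Taking the least maximizer
      makes the selection periodic, so the pieces \<open>g N\<close> are periodic as well.\<close>
    define \<nu> where "\<nu> = (\<lambda>n. LEAST N. N \<le> K \<and> A N n = F n)"
    define g where "g = (\<lambda>N n. if \<nu> n = N then F n else 0)"
    have perA: "A N (n + int M) = A N n" for N n
      using periodic_digit_avgs[OF per] by (simp add: A_def periodic_def)
    have "\<exists>N. N \<le> K \<and> A N n = F n" for n
    proof -
      have "F n \<in> (\<lambda>N. A N n) ` {..K}" unfolding F_def by (rule Max_in) auto
      then show ?thesis by auto
    qed
    from LeastI_ex[OF this] have \<nu>: "\<nu> n \<le> K" "A (\<nu> n) n = F n" for n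
      unfolding \<nu>_def by auto
    have F0: "0 \<le> F n" for n
      using \<nu>(2)[of n] digit_avgs_nonneg[of f, OF nn] unfolding A_def by metis
    have perF: "F (n + int M) = F n" for n by (simp add: F_def perA)
    have per\<nu>: "\<nu> (n + int M) = \<nu> n" for n by (simp add: \<nu>_def perA perF)
    have perg: "periodic M (g N)" for N by (simp add: periodic_def g_def perF per\<nu>)
    have g0: "0 \<le> g N n" for N n by (simp add: g_def F0)
    have sumg: "(\<Sum>N\<le>K. g N n) = F n" for n using \<nu>(1)[of n] by (simp add: g_def)
    define V where "V = (\<lambda>m. \<Sum>N\<le>K. cnj (\<Prod>t<N. digit_symbol D (unit_root M m ^ (d ^ t))) * dft M (g N) m)"
    define X where "X = (\<Sum>n\<in>{0..<int M}. (F n)\<^sup>2)"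
    define Y where "Y = (\<Sum>n\<in>{0..<int M}. (f n)\<^sup>2)"
    have V: "(\<Sum>m<M. (norm (V m))\<^sup>2) \<le> C * real M * X"
      using bound[OF M, of g K] perg g0 unfolding V_def X_def sumg .
    have X0: "0 \<le> X" and Y0: "0 \<le> Y" by (simp_all add: X_def Y_def sum_nonneg)
    have "of_real (real M * X) = (\<Sum>N\<le>K. of_nat M * complex_of_real (\<Sum>n\<in>{0..<int M}. A N n * g N n))"
    proof -
      have "(F n)\<^sup>2 = (\<Sum>N\<le>K. A N n * g N n)" for n
      proof -
        have "(\<Sum>N\<le>K. A N n * g N n) = (\<Sum>N\<le>K. if \<nu> n = N then A (\<nu> n) n * F n else 0)"
          by (intro sum.cong) (auto simp: g_def)
        then show ?thesis using \<nu>[of n] by (simp add: power2_eq_square)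
      qed
      then have "X = (\<Sum>N\<le>K. \<Sum>n\<in>{0..<int M}. A N n * g N n)"
        unfolding X_def by (subst sum.swap) simp
      then show ?thesis by (simp add: sum_distrib_left)
    qed
    also have "\<dots> = (\<Sum>N\<le>K. \<Sum>m<M. dft M (A N) m * cnj (dft M (g N) m))"
      unfolding dft_Parseval[OF M] ..
    also have "\<dots> = (\<Sum>m<M. dft M f m * cnj (V m))"
      by (subst sum.swap) (simp add: A_def dft_digit_avgs[OF M per] V_def sum_distrib_left mult_ac)
    finally have "real M * X = norm (\<Sum>m<M. dft M f m * cnj (V m))"
      using X0 by (metis norm_of_real abs_of_nonneg mult_nonneg_nonneg of_nat_0_le_iff)
    also have "\<dots> \<le> (\<Sum>m<M. norm (dft M f m) * norm (V m))"
      by (rule order_trans[OF norm_sum]) (simp add: norm_mult)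
    finally have "(real M * X)\<^sup>2 \<le> (\<Sum>m<M. norm (dft M f m) * norm (V m))\<^sup>2"
      using X0 by (intro power_mono) auto
    also have "\<dots> \<le> (\<Sum>m<M. (norm (dft M f m))\<^sup>2) * (\<Sum>m<M. (norm (V m))\<^sup>2)"
      by (rule Cauchy_Schwarz_ineq_sum)
    also have "\<dots> \<le> (real M * Y) * (C * real M * X)"
      unfolding dft_norm_squared[OF M] Y_def[symmetric] using Y0 by (intro mult_left_mono V) auto
    finally have "(real M)\<^sup>2 * (X * X) \<le> (real M)\<^sup>2 * (C * Y * X)"
      by (simp add: power2_eq_square mult_ac)
    then have "X * X \<le> C * Y * X" using M by simp
    then have "X \<le> C * Y" using X0 Y0 C by (cases "X = 0") auto
    then show ?thesis by (simp add: X_def Y_def F_def A_def)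
  qed
  show ?thesis
  proof (intro exI conjI allI impI)
    show "C > 0" by (rule C)
  qed (rule claim, auto)
qed

section \<open>The maximal inequality on the line\<close>

locale digit_system =
  fixes d :: nat and D :: "nat set"
  assumes d: "3 \<le> d" and D: "D \<subseteq> {0..<d}" "0 \<in> D"
begin

lemma finite_D: "finite D" using D(1) by (rule finite_subset) simp
lemma D_nonempty: "D \<noteq> {}" using D(2) by auto

sublocale digits: sequence_space "uniform_count_measure D"
proof -
  interpret product_prob_space "\<lambda>_ :: nat. uniform_count_measure D" UNIV
    by (intro product_prob_spaceI prob_space_uniform_count_measure finite_D D_nonempty)
  show "sequence_space (uniform_count_measure D)" by unfold_locales
qed

abbreviation \<nu> :: "real measure" where "\<nu> \<equiv> natural_measure d D"

sublocale \<nu>: prob_space \<nu>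
  by (rule prob_space_natural_measure[OF finite_D D_nonempty])

lemma sets_\<nu> [measurable_cong, simp]: "sets \<nu> = sets borel"
  by (simp add: natural_measure_def)

lemma space_\<nu> [simp]: "space \<nu> = UNIV"
  by (simp add: natural_measure_def)

lemma digits_in_D: "\<omega> \<in> space (digit_measure D) \<Longrightarrow> \<omega> j \<in> D"
  by (auto simp: digit_measure_def space_PiM PiE_iff space_uniform_count_measure)

lemma digit_series_summable:
  assumes "\<And>j. a j < d"
  shows "summable (\<lambda>j. real (a j) / real d ^ Suc j)"
proof (rule summable_comparison_test')
  show "summable (\<lambda>j. (1 / real d) ^ j)" using d by (intro summable_geometric) auto
  fix n assume "n \<ge> (0::nat)"
  have "real (a n) / real d ^ Suc n \<le> real d / real d ^ Suc n"
    using assms[of n] by (intro divide_right_mono) auto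
  also have "\<dots> = (1 / real d) ^ n" using d by (simp add: power_divide)
  finally show "norm (real (a n) / real d ^ Suc n) \<le> (1 / real d) ^ n" by simp
qed

lemma digit_sum_case_nat:
  assumes "\<And>j. \<omega> j < d" "a < d"
  shows "digit_sum d (case_nat a \<omega>) = (real a + digit_sum d \<omega>) / real d"
proof -
  let ?f = "\<lambda>j. real (case_nat a \<omega> j) / real d ^ Suc j"
  have "summable ?f"
    by (rule digit_series_summable) (use assms in \<open>auto split: nat.split\<close>)
  from suminf_split_head[OF this] have "suminf ?f = ?f 0 + (\<Sum>j. ?f (Suc j))" by linarith
  also have "(\<Sum>j. ?f (Suc j)) = (\<Sum>j. (real (\<omega> j) / real d ^ Suc j) / real d)"
    by (simp add: mult_ac)
  also have "\<dots> = digit_sum d \<omega> / real d"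
    unfolding digit_sum_def by (rule suminf_divide) (rule digit_series_summable[OF assms(1)])
  finally show ?thesis by (simp add: digit_sum_def add_divide_distrib)
qed

lemma AE_\<nu>_bounds: "AE t in \<nu>. 0 \<le> t \<and> t \<le> 1"
proof -
  have "0 \<le> digit_sum d \<omega> \<and> digit_sum d \<omega> \<le> 1" if "\<omega> \<in> space (digit_measure D)" for \<omega>
  proof -
    have lt: "\<omega> j < d" for j using digits_in_D[OF that, of j] D by auto
    note sm = digit_series_summable[of \<omega>, OF lt]
    have "0 \<le> digit_sum d \<omega>" unfolding digit_sum_def by (intro suminf_nonneg sm) auto
    moreover have "digit_sum d \<omega> \<le> (\<Sum>j. (real d - 1) / real d * (1 / real d) ^ j)"
      unfolding digit_sum_def
    proof (rule suminf_le[OF _ sm])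
      show "real (\<omega> j) / real d ^ Suc j \<le> (real d - 1) / real d * (1 / real d) ^ j" for j
      proof -
        have "real (\<omega> j) \<le> real d - 1" using lt[of j] by linarith
        then have "real (\<omega> j) / real d ^ Suc j \<le> (real d - 1) / real d ^ Suc j"
          by (intro divide_right_mono) auto
        then show ?thesis by (simp add: power_divide)
      qed
      show "summable (\<lambda>j. (real d - 1) / real d * (1 / real d) ^ j)"
        using d by (intro summable_mult summable_geometric) auto
    qed
    moreover have "(\<Sum>j. (real d - 1) / real d * (1 / real d) ^ j) = 1"
      using d by (subst suminf_mult) (auto simp: suminf_geometric summable_geometric field_simps)
    ultimately show ?thesis by simp
  qed
  then have "AE \<omega> in digit_measure D. 0 \<le> digit_sum d \<omega> \<and> digit_sum d \<omega> \<le> 1" by (intro AE_I2) auto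
  then show ?thesis
    unfolding natural_measure_def using digit_sum_measurable[of d D]
    by (subst AE_distr_iff) auto
qed

lemma nn_integral_uniform_D:
  "(\<integral>\<^sup>+a. h a \<partial>uniform_count_measure D) = ennreal (1 / real (card D)) * (\<Sum>a\<in>D. h a)"
  unfolding uniform_count_measure_def
  by (simp add: nn_integral_point_measure_finite[OF finite_D] sum_distrib_left)

text \<open>Self-similarity: prepending an independent digit maps the product measure to itself, and
  on \<open>digit_sum\<close> it acts as \<open>t \<mapsto> (a + t) / d\<close>.\<close>

lemma nn_integral_\<nu>_iterate:
  assumes h [measurable]: "h \<in> borel_measurable borel"
  shows "(\<integral>\<^sup>+t. h t \<partial>\<nu>) = ennreal (1 / real (card D)) * (\<Sum>a\<in>D. \<integral>\<^sup>+t. h ((real a + t) / real d) \<partial>\<nu>)"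
proof -
  let ?S = "digit_measure D" and ?U = "uniform_count_measure D"
  have S: "(\<Pi>\<^sub>M i\<in>UNIV. uniform_count_measure D) = ?S" by (simp add: digit_measure_def)
  have ds [measurable]: "digit_sum d \<in> borel_measurable ?S" by (rule digit_sum_measurable)
  have [measurable]: "(\<lambda>(s, \<omega>). case_nat s \<omega>) \<in> measurable (?U \<Otimes>\<^sub>M ?S) ?S"
    unfolding digit_measure_def by measurable
  have "(\<integral>\<^sup>+t. h t \<partial>\<nu>) = (\<integral>\<^sup>+\<omega>. h (digit_sum d \<omega>) \<partial>?S)"
    unfolding natural_measure_def by (subst nn_integral_distr) auto
  also have "\<dots> = (\<integral>\<^sup>+\<omega>. h (digit_sum d \<omega>) \<partial>distr (?U \<Otimes>\<^sub>M ?S) ?S (\<lambda>(s, \<omega>). case_nat s \<omega>))"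
    using digits.PiM_iter unfolding S by simp
  also have "\<dots> = (\<integral>\<^sup>+p. h (digit_sum d (case_nat (fst p) (snd p))) \<partial>(?U \<Otimes>\<^sub>M ?S))"
    by (subst nn_integral_distr) (auto simp: case_prod_beta)
  also have "\<dots> = (\<integral>\<^sup>+s. \<integral>\<^sup>+\<omega>. h (digit_sum d (case_nat s \<omega>)) \<partial>?S \<partial>?U)"
    using digits.P.sigma_finite_measure_axioms unfolding S
    by (subst sigma_finite_measure.nn_integral_fst[symmetric]) (auto simp: case_prod_beta)
  also have "\<dots> = ennreal (1 / real (card D)) * (\<Sum>a\<in>D. \<integral>\<^sup>+\<omega>. h (digit_sum d (case_nat a \<omega>)) \<partial>?S)"
    by (rule nn_integral_uniform_D)
  also have "(\<Sum>a\<in>D. \<integral>\<^sup>+\<omega>. h (digit_sum d (case_nat a \<omega>)) \<partial>?S) = (\<Sum>a\<in>D. \<integral>\<^sup>+t. h ((real a + t) / real d) \<partial>\<nu>)"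
  proof (intro sum.cong refl)
    fix a assume a: "a \<in> D"
    have "(\<integral>\<^sup>+\<omega>. h (digit_sum d (case_nat a \<omega>)) \<partial>?S) = (\<integral>\<^sup>+\<omega>. h ((real a + digit_sum d \<omega>) / real d) \<partial>?S)"
    proof (rule nn_integral_cong)
      fix \<omega> assume \<omega>: "\<omega> \<in> space ?S"
      have "\<omega> j < d" for j using digits_in_D[OF \<omega>, of j] D by auto
      then show "h (digit_sum d (case_nat a \<omega>)) = h ((real a + digit_sum d \<omega>) / real d)"
        using digit_sum_case_nat[of \<omega> a] a D by auto
    qed
    also have "\<dots> = (\<integral>\<^sup>+t. h ((real a + t) / real d) \<partial>\<nu>)"
      unfolding natural_measure_def by (subst nn_integral_distr) auto
    finally show "(\<integral>\<^sup>+\<omega>. h (digit_sum d (case_nat a \<omega>)) \<partial>?S) = (\<integral>\<^sup>+t. h ((real a + t) / real d) \<partial>\<nu>)" .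
  qed
  finally show ?thesis .
qed

section \<open>Averages of nonnegative functions against the natural measure\<close>

definition cantor_avg :: "nat \<Rightarrow> (real \<Rightarrow> ennreal) \<Rightarrow> real \<Rightarrow> ennreal" where
  "cantor_avg k f x = (\<integral>\<^sup>+t. f (x - t / real d ^ k) \<partial>\<nu>)"

lemma measurable_cantor_avg [measurable]:
  assumes [measurable]: "f \<in> borel_measurable borel"
  shows "cantor_avg k f \<in> borel_measurable borel"
  unfolding cantor_avg_def[abs_def] by measurable

text \<open>The direction matters: a coarser average is a digit average of the next finer one, so
  all scales up to \<open>K\<close> are determined by scale \<open>K\<close>.\<close>

lemma cantor_avg_Suc:
  assumes [measurable]: "f \<in> borel_measurable borel"
  shows "cantor_avg k f x = ennreal (1 / real (card D)) * (\<Sum>a\<in>D. cantor_avg (Suc k) f (x - real a / real d ^ Suc k))"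
proof -
  have *: "x - (real a + t) / real d / real d ^ k = x - real a / real d ^ Suc k - t / real d ^ Suc k" for a t
    by (simp add: add_divide_distrib algebra_simps)
  then show ?thesis
    unfolding cantor_avg_def by (subst nn_integral_\<nu>_iterate, measurable) (simp only: *)
qed

lemma nn_integral_cantor_avg:
  assumes [measurable]: "f \<in> borel_measurable borel"
  shows "(\<integral>\<^sup>+x. cantor_avg k f x \<partial>lborel) = (\<integral>\<^sup>+x. f x \<partial>lborel)"
proof -
  interpret pair_sigma_finite lborel \<nu> ..
  have "(\<integral>\<^sup>+x. cantor_avg k f x \<partial>lborel) = (\<integral>\<^sup>+t. \<integral>\<^sup>+x. f (x - t / real d ^ k) \<partial>lborel \<partial>\<nu>)"
    unfolding cantor_avg_def by (rule Fubini'[symmetric]) measurable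
  also have "\<dots> = (\<integral>\<^sup>+t. \<integral>\<^sup>+x. f x \<partial>lborel \<partial>\<nu>)"
  proof (rule nn_integral_cong)
    fix t
    show "(\<integral>\<^sup>+x. f (x - t / real d ^ k) \<partial>lborel) = (\<integral>\<^sup>+x. f x \<partial>lborel)"
      using nn_integral_real_affine[of f 1 "- (t / real d ^ k)"] by simp
  qed
  also have "\<dots> = (\<integral>\<^sup>+x. f x \<partial>lborel)" by (simp add: \<nu>.emeasure_space_1[simplified])
  finally show ?thesis .
qed

lemma cantor_avg_squared_le:
  assumes [measurable]: "f \<in> borel_measurable borel"
  shows "(cantor_avg k f x)\<^sup>2 \<le> cantor_avg k (\<lambda>x. (f x)\<^sup>2) x"
  using Cauchy_Schwarz_nn_integral[of "\<lambda>t. f (x - t / real d ^ k)" \<nu> "\<lambda>_. 1"]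
  by (simp add: cantor_avg_def \<nu>.emeasure_space_1[simplified])

lemma nn_integral_cantor_avg_squared_le:
  assumes [measurable]: "f \<in> borel_measurable borel"
  shows "(\<integral>\<^sup>+x. (cantor_avg k f x)\<^sup>2 \<partial>lborel) \<le> (\<integral>\<^sup>+x. (f x)\<^sup>2 \<partial>lborel)"
proof -
  have "(\<integral>\<^sup>+x. (cantor_avg k f x)\<^sup>2 \<partial>lborel) \<le> (\<integral>\<^sup>+x. cantor_avg k (\<lambda>x. (f x)\<^sup>2) x \<partial>lborel)"
    by (intro nn_integral_mono cantor_avg_squared_le) measurable
  also have "\<dots> = (\<integral>\<^sup>+x. (f x)\<^sup>2 \<partial>lborel)" by (intro nn_integral_cantor_avg) measurable
  finally show ?thesis .
qed

end

section \<open>From lattice samples to the line\<close>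

lemma periodic_sum_window:
  assumes "M > 0" "periodic M f"
  shows "(\<Sum>n\<in>{c..<c + int M}. f n) = (\<Sum>n\<in>{0..<int M}. f n)"
proof -
  have "(\<Sum>n\<in>{c..<c + int M}. f n) = (\<Sum>n\<in>{0..<int M}. f (n + c))"
    by (rule sum.reindex_bij_witness[of _ "\<lambda>n. n + c" "\<lambda>n. n - c"]) auto
  then show ?thesis using periodic_sum_shift[OF assms] by simp
qed

lemma nn_integral_unfold:
  fixes F :: "real \<Rightarrow> ennreal" and p q :: int
  assumes [measurable]: "F \<in> borel_measurable borel"
  shows "(\<integral>\<^sup>+x\<in>{of_int p..<of_int q}. F x \<partial>lborel) = (\<integral>\<^sup>+y\<in>{0..<1}. (\<Sum>n\<in>{p..<q}. F (y + of_int n)) \<partial>lborel)"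
proof -
  have ind: "indicator {of_int p..<of_int q} x = (\<Sum>n\<in>{p..<q}. indicator {of_int n..<of_int n + 1} x :: ennreal)" for x :: real
  proof -
    have "indicator {of_int n..<of_int n + 1} x = (if n = \<lfloor>x\<rfloor> then 1 else 0 :: ennreal)" for n
      by (auto simp: indicator_def floor_unique)
    then have "(\<Sum>n\<in>{p..<q}. indicator {of_int n..<of_int n + 1} x :: ennreal) = (if \<lfloor>x\<rfloor> \<in> {p..<q} then 1 else 0)"
      by simp
    also have "\<dots> = indicator {of_int p..<of_int q} x"
      by (auto simp: indicator_def le_floor_iff floor_less_iff)
    finally show ?thesis by simp
  qed
  have "(\<integral>\<^sup>+x\<in>{of_int p..<of_int q}. F x \<partial>lborel) = (\<Sum>n\<in>{p..<q}. \<integral>\<^sup>+x. F x * indicator {of_int n..<of_int n + 1} x \<partial>lborel)"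
    unfolding ind sum_distrib_left by (subst nn_integral_sum) auto
  also have "\<dots> = (\<Sum>n\<in>{p..<q}. \<integral>\<^sup>+y. F (y + of_int n) * indicator {0..<1} y \<partial>lborel)"
  proof (intro sum.cong refl)
    fix n
    have "indicator {of_int n..<of_int n + 1} (of_int n + y) = (indicator {0..<1} y :: ennreal)" for y :: real
      by (auto simp: indicator_def)
    then show "(\<integral>\<^sup>+x. F x * indicator {of_int n..<of_int n + 1} x \<partial>lborel) = (\<integral>\<^sup>+y. F (y + of_int n) * indicator {0..<1} y \<partial>lborel)"
      by (subst nn_integral_real_affine[where c=1 and t="of_int n"]) (auto simp: add.commute)
  qed
  also have "\<dots> = (\<integral>\<^sup>+y\<in>{0..<1}. (\<Sum>n\<in>{p..<q}. F (y + of_int n)) \<partial>lborel)"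
    unfolding sum_distrib_right by (subst nn_integral_sum) auto
  finally show ?thesis .
qed

context digit_system
begin

text \<open>On the mesh \<open>d^-K\<close>, a digit shift at scale \<open>K - N\<close> is
  \<open>a * d^N\<close> lattice steps. After \<open>N\<close> averages the look-back is at most
  \<open>(d - 1) * (1 + ... + d^(N-1)) = d^N - 1\<close> sites, which is the margin required at the
  left end.\<close>

lemma sampled_digit_avgs:
  fixes f :: "real \<Rightarrow> ennreal" and \<phi> :: "int \<Rightarrow> real" and c :: int
  assumes [measurable]: "f \<in> borel_measurable borel"
    and \<phi>: "\<And>n. c \<le> n \<Longrightarrow> n < e \<Longrightarrow> cantor_avg K f ((y + of_int n) / real d ^ K) = ennreal (\<phi> n)"
    and \<phi>0: "\<And>n. 0 \<le> \<phi> n"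
    and N: "N \<le> K" and n: "c + int d ^ N - 1 \<le> n" "n < e"
  shows "cantor_avg (K - N) f ((y + of_int n) / real d ^ K) = ennreal (digit_avgs D d N \<phi> n)"
  using N n
proof (induction N arbitrary: n)
  case 0
  then show ?case by (simp add: \<phi>)
next
  case (Suc N)
  have K: "K - N = Suc (K - Suc N)" using Suc.prems by simp
  have shift: "cantor_avg (K - N) f ((y + of_int n) / real d ^ K - real a / real d ^ (K - N))
      = ennreal (digit_avgs D d N \<phi> (n - int (a * d ^ N)))" if a: "a \<in> D" for a
  proof -
    have "real d ^ K = real d ^ (K - N) * real d ^ N"
      using Suc.prems by (simp flip: power_add)
    then have "(y + of_int n) / real d ^ K - real a / real d ^ (K - N) = (y + of_int (n - int (a * d ^ N))) / real d ^ K"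
      using d by (simp add: field_simps)
    moreover have "c + int d ^ N - 1 \<le> n - int (a * d ^ N) \<and> n - int (a * d ^ N) < e"
    proof -
      have "int a * int d ^ N \<le> (int d - 1) * int d ^ N" using a D by (intro mult_right_mono) auto
      then have "int (a * d ^ N) \<le> int d ^ Suc N - int d ^ N" by (simp add: algebra_simps)
      then show ?thesis using Suc.prems by linarith
    qed
    ultimately show ?thesis using Suc.IH[of "n - int (a * d ^ N)"] Suc.prems by simp
  qed
  have "cantor_avg (K - Suc N) f ((y + of_int n) / real d ^ K)
      = ennreal (1 / real (card D)) * (\<Sum>a\<in>D. ennreal (digit_avgs D d N \<phi> (n - int (a * d ^ N))))"
    by (subst cantor_avg_Suc) (simp_all add: K[symmetric] shift del: of_nat_mult)
  also have "\<dots> = ennreal (digit_avgs D d (Suc N) \<phi> n)"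
    by (simp add: digit_avg_def sum_ennreal digit_avgs_nonneg \<phi>0 ennreal_mult'[symmetric] sum_nonneg del: of_nat_mult)
  finally show ?case .
qed

lemma sampled_maximal_inequality:
  "\<exists>C>0::real. \<forall>f\<in>borel_measurable borel. \<forall>K B y.
      (\<Sum>n\<in>{- (int B * int d ^ K)..<int B * int d ^ K}. (SUP k\<in>{..K}. cantor_avg k f ((y + of_int n) / real d ^ K))\<^sup>2)
      \<le> ennreal C * (\<Sum>n\<in>{- (int (Suc B) * int d ^ K)..<int B * int d ^ K}. (cantor_avg K f ((y + of_int n) / real d ^ K))\<^sup>2)"
proof -
  obtain C where C: "C > 0"
    and max: "\<And>K M f. M > 0 \<Longrightarrow> periodic M f \<Longrightarrow> (\<And>n. 0 \<le> f n) \<Longrightarrow>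
      (\<Sum>n\<in>{0..<int M}. (Max ((\<lambda>N. digit_avgs D d N f n) ` {..K}))\<^sup>2) \<le> C * (\<Sum>n\<in>{0..<int M}. (f n)\<^sup>2)"
    using discrete_maximal_inequality[OF d finite_D D(2)] by auto
  have claim: "(\<Sum>n\<in>{- (int B * int d ^ K)..<int B * int d ^ K}. (SUP k\<in>{..K}. cantor_avg k f ((y + of_int n) / real d ^ K))\<^sup>2)
      \<le> ennreal C * (\<Sum>n\<in>{- (int (Suc B) * int d ^ K)..<int B * int d ^ K}. (cantor_avg K f ((y + of_int n) / real d ^ K))\<^sup>2)"
    if f: "f \<in> borel_measurable borel" for f K B y
  proof -
    define h where "h = (\<lambda>n. cantor_avg K f ((y + of_int n) / real d ^ K))"
    \<comment> \<open>One extra block of \<open>d^K\<close> sites on the left covers the whole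
      look-back, so wrapping the enlarged window around with period \<open>M\<close> does not affect
      the averages on the original window.\<close>
    define c where "c = - (int (Suc B) * int d ^ K)"
    define M where "M = (2 * B + 1) * d ^ K"
    have dK: "d ^ K > 0" using d by simp
    then have M: "M > 0" by (simp add: M_def)
    have cM: "c + int M = int B * int d ^ K" by (simp add: c_def M_def algebra_simps)
    have cd: "c + int d ^ K = - (int B * int d ^ K)" by (simp add: c_def algebra_simps)
    \<comment> \<open>proof (cases "\<exists>n\<in>{c..<c + int M}. h n = \<infinity>") An infinite
      sample makes the right side infinite; otherwise the samples are real and can be repeated with
      period \<open>M\<close>.\<close>
    show ?thesis
    proof (cases "\<exists>n\<in>{c..<c + int M}. h n = \<infinity>")
      case True
      then obtain n where n: "n \<in> {c..<c + int M}" "h n = \<infinity>" by blast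
      then have "(h n)\<^sup>2 \<le> (\<Sum>n\<in>{c..<c + int M}. (h n)\<^sup>2)"
        by (intro member_le_sum) auto
      then have "(\<Sum>n\<in>{c..<c + int M}. (h n)\<^sup>2) = \<infinity>" using n(2) by (simp add: top_unique)
      then have "ennreal C * (\<Sum>n\<in>{c..<c + int M}. (h n)\<^sup>2) = \<infinity>" using C by (simp add: ennreal_mult_eq_top_iff)
      then show ?thesis unfolding cM[symmetric] by (simp add: h_def c_def)
    next
      case False
      define \<phi> where "\<phi> = (\<lambda>n. enn2real (h (c + (n - c) mod int M)))"
      have per: "periodic M \<phi>"
        unfolding periodic_def
      proof
        fix n
        have "n + int M - c = (n - c) + int M" by simp
        then show "\<phi> (n + int M) = \<phi> n" by (simp only: \<phi>_def mod_add_self2)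
      qed
      have \<phi>0: "0 \<le> \<phi> n" for n by (simp add: \<phi>_def)
      have \<phi>h: "h n = ennreal (\<phi> n)" if "c \<le> n" "n < c + int M" for n
        using that False by (auto simp: \<phi>_def less_top)
      define A where "A = (\<lambda>n. Max ((\<lambda>N. digit_avgs D d N \<phi> n) ` {..K}))"
      have A0: "0 \<le> A n" for n
      proof -
        have "(\<lambda>N. digit_avgs D d N \<phi> n) 0 \<in> (\<lambda>N. digit_avgs D d N \<phi> n) ` {..K}"
          by (rule imageI) simp
        then have "digit_avgs D d 0 \<phi> n \<le> A n"
          unfolding A_def by (rule Max_ge[OF finite_imageI[OF finite_atMost]])
        moreover have "digit_avgs D d 0 \<phi> n = \<phi> n" by (rule fun_cong[OF digit_avgs.simps(1)])
        ultimately show ?thesis using \<phi>0[of n] by linarith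
      qed
      have SUP_le: "(SUP k\<in>{..K}. cantor_avg k f ((y + of_int n) / real d ^ K)) \<le> ennreal (A n)"
        if n: "c + int d ^ K \<le> n" "n < c + int M" for n
      proof (rule SUP_least)
        fix k assume k: "k \<in> {..K}"
        have "int d ^ (K - k) \<le> int d ^ K" using d by (intro power_increasing) auto
        then have "cantor_avg (K - (K - k)) f ((y + of_int n) / real d ^ K) = ennreal (digit_avgs D d (K - k) \<phi> n)"
          using n by (intro sampled_digit_avgs[OF f \<phi>h[unfolded h_def] \<phi>0]) auto
        then show "cantor_avg k f ((y + of_int n) / real d ^ K) \<le> ennreal (A n)"
          using k by (auto simp: A_def intro!: ennreal_leI Max_ge)
      qed
      have sub: "{- (int B * int d ^ K)..<int B * int d ^ K} \<subseteq> {c..<c + int M}"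
      proof -
        have "0 \<le> int d ^ K" by simp
        then have "c \<le> - (int B * int d ^ K)" using cd by linarith
        then show ?thesis unfolding cM by auto
      qed
      have "(\<Sum>n\<in>{- (int B * int d ^ K)..<int B * int d ^ K}. (SUP k\<in>{..K}. cantor_avg k f ((y + of_int n) / real d ^ K))\<^sup>2)
          \<le> (\<Sum>n\<in>{- (int B * int d ^ K)..<int B * int d ^ K}. ennreal ((A n)\<^sup>2))"
        unfolding ennreal_power[OF A0, symmetric] using cd cM
        by (intro sum_mono power_mono SUP_le) auto
      also have "\<dots> \<le> (\<Sum>n\<in>{c..<c + int M}. ennreal ((A n)\<^sup>2))"
        by (intro sum_mono2 sub) auto
      also have "\<dots> = ennreal (\<Sum>n\<in>{c..<c + int M}. (A n)\<^sup>2)" by (simp add: sum_ennreal)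
      also have "(\<Sum>n\<in>{c..<c + int M}. (A n)\<^sup>2) = (\<Sum>n\<in>{0..<int M}. (A n)\<^sup>2)"
        using periodic_digit_avgs[OF per] by (intro periodic_sum_window[OF M]) (simp add: periodic_def A_def)
      also have "ennreal \<dots> \<le> ennreal (C * (\<Sum>n\<in>{0..<int M}. (\<phi> n)\<^sup>2))"
        unfolding A_def by (intro ennreal_leI max[OF M per \<phi>0])
      also have "(\<Sum>n\<in>{0..<int M}. (\<phi> n)\<^sup>2) = (\<Sum>n\<in>{c..<c + int M}. (\<phi> n)\<^sup>2)"
        using per by (intro periodic_sum_window[OF M, symmetric]) (simp add: periodic_def)
      also have "ennreal (C * (\<Sum>n\<in>{c..<c + int M}. (\<phi> n)\<^sup>2)) = ennreal C * (\<Sum>n\<in>{c..<c + int M}. (ennreal (\<phi> n))\<^sup>2)"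
      proof -
        have "(\<Sum>n\<in>{c..<c + int M}. (ennreal (\<phi> n))\<^sup>2) = ennreal (\<Sum>n\<in>{c..<c + int M}. (\<phi> n)\<^sup>2)"
          by (simp add: ennreal_power \<phi>0)
        then show ?thesis using C by (simp add: ennreal_mult' sum_nonneg)
      qed
      also have "(\<Sum>n\<in>{c..<c + int M}. (ennreal (\<phi> n))\<^sup>2) = (\<Sum>n\<in>{c..<c + int M}. (h n)\<^sup>2)"
        by (intro sum.cong) (auto simp: \<phi>h)
      finally show ?thesis unfolding cM by (simp add: h_def c_def)
    qed
  qed
  show ?thesis
  proof (intro exI conjI ballI allI)
    show "C > 0" by (rule C)
  qed (rule claim)
qed

text \<open>Integrating the sampled inequality over the offset \<open>y\<close> in the unit interval
  and rescaling by \<open>d^-K\<close> recovers integrals over the line. On the right, averaging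
  contracts the \<open>L^2\<close> norm, so \<open>cantor_avg K f\<close> may be replaced by
  \<open>f\<close>.\<close>

lemma finite_range_maximal_inequality:
  "\<exists>C>0::real. \<forall>f\<in>borel_measurable borel. \<forall>K B.
      (\<integral>\<^sup>+x\<in>{- real B..<real B}. (SUP k\<in>{..K}. cantor_avg k f x)\<^sup>2 \<partial>lborel) \<le> ennreal C * (\<integral>\<^sup>+x. (f x)\<^sup>2 \<partial>lborel)"
proof -
  obtain C where C: "C > 0" and max: "\<And>f K B y. f \<in> borel_measurable borel \<Longrightarrow>
      (\<Sum>n\<in>{- (int B * int d ^ K)..<int B * int d ^ K}. (SUP k\<in>{..K}. cantor_avg k f ((y + of_int n) / real d ^ K))\<^sup>2)
      \<le> ennreal C * (\<Sum>n\<in>{- (int (Suc B) * int d ^ K)..<int B * int d ^ K}. (cantor_avg K f ((y + of_int n) / real d ^ K))\<^sup>2)"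
    using sampled_maximal_inequality by auto
  have claim: "(\<integral>\<^sup>+x\<in>{- real B..<real B}. (SUP k\<in>{..K}. cantor_avg k f x)\<^sup>2 \<partial>lborel) \<le> ennreal C * (\<integral>\<^sup>+x. (f x)\<^sup>2 \<partial>lborel)"
    if f [measurable]: "f \<in> borel_measurable borel" for f K B
  proof -
    define s where "s = 1 / real d ^ K"
    have s: "s > 0" using d by (simp add: s_def)
    define F where "F = (\<lambda>x. (SUP k\<in>{..K}. cantor_avg k f x)\<^sup>2)"
    have F [measurable]: "F \<in> borel_measurable borel"
    proof -
      have [measurable]: "(\<lambda>x. SUP k\<in>{..K}. cantor_avg k f x) \<in> borel_measurable borel"
        by (intro borel_measurable_SUP) auto
      show ?thesis unfolding F_def by measurable
    qed
    have rescale: "(\<integral>\<^sup>+x\<in>{real_of_int p * s..<real_of_int q * s}. G x \<partial>lborel)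
        = ennreal s * (\<integral>\<^sup>+y\<in>{0..<1}. (\<Sum>n\<in>{p..<q}. G ((y + of_int n) / real d ^ K)) \<partial>lborel)"
      if [measurable]: "G \<in> borel_measurable borel" for G p q
    proof -
      have "indicator {real_of_int p * s..<real_of_int q * s} (0 + s * x) = (indicator {real_of_int p..<real_of_int q} x :: ennreal)" for x
        using s by (auto simp: indicator_def mult.commute[of s])
      then have "(\<integral>\<^sup>+x\<in>{real_of_int p * s..<real_of_int q * s}. G x \<partial>lborel)
          = ennreal s * (\<integral>\<^sup>+x\<in>{real_of_int p..<real_of_int q}. G (x / real d ^ K) \<partial>lborel)"
        using s by (subst nn_integral_real_affine[where c=s and t=0]) (auto simp: s_def)
      also have "(\<integral>\<^sup>+x\<in>{real_of_int p..<real_of_int q}. G (x / real d ^ K) \<partial>lborel)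
          = (\<integral>\<^sup>+y\<in>{0..<1}. (\<Sum>n\<in>{p..<q}. G ((y + of_int n) / real d ^ K)) \<partial>lborel)"
        by (rule nn_integral_unfold) measurable
      finally show ?thesis .
    qed
    have B: "real_of_int (- (int B * int d ^ K)) * s = - real B" "real_of_int (int B * int d ^ K) * s = real B"
      using d by (simp_all add: s_def)
    have "(\<integral>\<^sup>+x\<in>{- real B..<real B}. F x \<partial>lborel)
        = (\<integral>\<^sup>+x\<in>{real_of_int (- (int B * int d ^ K)) * s..<real_of_int (int B * int d ^ K) * s}. F x \<partial>lborel)"
      unfolding B ..
    also have "\<dots> = ennreal s * (\<integral>\<^sup>+y\<in>{0..<1}. (\<Sum>n\<in>{- (int B * int d ^ K)..<int B * int d ^ K}. F ((y + of_int n) / real d ^ K)) \<partial>lborel)"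
      by (rule rescale) measurable
    also have "\<dots> \<le> ennreal s * (\<integral>\<^sup>+y\<in>{0..<1}. ennreal C * (\<Sum>n\<in>{- (int (Suc B) * int d ^ K)..<int B * int d ^ K}. (cantor_avg K f ((y + of_int n) / real d ^ K))\<^sup>2) \<partial>lborel)"
      unfolding F_def by (intro mult_left_mono nn_integral_mono mult_right_mono max f) auto
    also have "\<dots> = ennreal C * (ennreal s * (\<integral>\<^sup>+y\<in>{0..<1}. (\<Sum>n\<in>{- (int (Suc B) * int d ^ K)..<int B * int d ^ K}. (cantor_avg K f ((y + of_int n) / real d ^ K))\<^sup>2) \<partial>lborel))"
      by (simp add: mult.assoc nn_integral_cmult mult.left_commute)
    also have "\<dots> = ennreal C * (\<integral>\<^sup>+x\<in>{real_of_int (- (int (Suc B) * int d ^ K)) * s..<real_of_int (int B * int d ^ K) * s}. (cantor_avg K f x)\<^sup>2 \<partial>lborel)"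
      by (subst rescale) auto
    also have "\<dots> \<le> ennreal C * (\<integral>\<^sup>+x. (cantor_avg K f x)\<^sup>2 \<partial>lborel)"
      by (intro mult_left_mono nn_integral_mono) (auto simp: indicator_def)
    also have "\<dots> \<le> ennreal C * (\<integral>\<^sup>+x. (f x)\<^sup>2 \<partial>lborel)"
      by (intro mult_left_mono nn_integral_cantor_avg_squared_le) auto
    finally show ?thesis by (simp add: F_def)
  qed
  show ?thesis
  proof (intro exI conjI ballI allI)
    show "C > 0" by (rule C)
  qed (rule claim)
qed

lemma weak_type_inequality:
  "\<exists>C>0::real. \<forall>f\<in>borel_measurable borel. \<forall>c.
      c\<^sup>2 * emeasure lborel {x. \<exists>k. c < cantor_avg k f x} \<le> ennreal C * (\<integral>\<^sup>+x. (f x)\<^sup>2 \<partial>lborel)"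
proof -
  obtain C where C: "C > 0" and max: "\<And>f K B. f \<in> borel_measurable borel \<Longrightarrow>
      (\<integral>\<^sup>+x\<in>{- real B..<real B}. (SUP k\<in>{..K}. cantor_avg k f x)\<^sup>2 \<partial>lborel) \<le> ennreal C * (\<integral>\<^sup>+x. (f x)\<^sup>2 \<partial>lborel)"
    using finite_range_maximal_inequality by auto
  have claim: "c\<^sup>2 * emeasure lborel {x. \<exists>k. c < cantor_avg k f x} \<le> ennreal C * (\<integral>\<^sup>+x. (f x)\<^sup>2 \<partial>lborel)"
    if f [measurable]: "f \<in> borel_measurable borel" for f and c :: ennreal
  proof -
    \<comment> \<open>The window and the number of scales grow together, so one increasing sequence
      exhausts the level set; Chebyshev applies to each member with the same constant.\<close>
    define A where "A = (\<lambda>K. {x. (- real K \<le> x \<and> x < real K) \<and> (\<exists>k\<le>K. c < cantor_avg k f x)})"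
    have A [measurable]: "A K \<in> sets lborel" for K unfolding A_def by measurable
    have mono: "incseq A"
      unfolding incseq_def A_def
    proof (intro allI impI subsetI)
      fix m n x assume "m \<le> n" and "x \<in> {x. (- real m \<le> x \<and> x < real m) \<and> (\<exists>k\<le>m. c < cantor_avg k f x)}"
      then show "x \<in> {x. (- real n \<le> x \<and> x < real n) \<and> (\<exists>k\<le>n. c < cantor_avg k f x)}"
        using le_trans by fastforce
    qed
    have UN: "(\<Union>K. A K) = {x. \<exists>k. c < cantor_avg k f x}"
    proof (intro equalityI subsetI)
      fix x assume "x \<in> {x. \<exists>k. c < cantor_avg k f x}"
      then obtain k where k: "c < cantor_avg k f x" by blast
      obtain m :: nat where m: "\<bar>x\<bar> < real m" using reals_Archimedean2 by blast
      have "x \<in> A (max k m)" unfolding A_def using k m by (auto intro!: exI[of _ k])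
      then show "x \<in> (\<Union>K. A K)" by blast
    qed (auto simp: A_def)
    have each: "c\<^sup>2 * emeasure lborel (A K) \<le> ennreal C * (\<integral>\<^sup>+x. (f x)\<^sup>2 \<partial>lborel)" for K
    proof -
      have "c\<^sup>2 * emeasure lborel (A K) = (\<integral>\<^sup>+x. c\<^sup>2 * indicator (A K) x \<partial>lborel)"
        using nn_integral_cmult_indicator[OF A] by simp
      also have "\<dots> \<le> (\<integral>\<^sup>+x\<in>{- real K..<real K}. (SUP k\<in>{..K}. cantor_avg k f x)\<^sup>2 \<partial>lborel)"
      proof (intro nn_integral_mono)
        fix x
        show "c\<^sup>2 * indicator (A K) x \<le> (SUP k\<in>{..K}. cantor_avg k f x)\<^sup>2 * indicator {- real K..<real K} x"
        proof (cases "x \<in> A K")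
          case True
          then obtain k where k: "k \<le> K" "c < cantor_avg k f x" and x: "x \<in> {- real K..<real K}"
            by (auto simp: A_def)
          have "c \<le> (SUP k\<in>{..K}. cantor_avg k f x)"
            using k by (intro SUP_upper2[of k]) auto
          then show ?thesis using x True by (simp add: power_mono)
        qed simp
      qed
      also have "\<dots> \<le> ennreal C * (\<integral>\<^sup>+x. (f x)\<^sup>2 \<partial>lborel)" by (rule max[OF f])
      finally show ?thesis .
    qed
    have "c\<^sup>2 * emeasure lborel {x. \<exists>k. c < cantor_avg k f x} = (SUP K. c\<^sup>2 * emeasure lborel (A K))"
    proof -
      have "range A \<subseteq> sets lborel" using A by blast
      from SUP_emeasure_incseq[OF this mono]
      have "emeasure lborel {x. \<exists>k. c < cantor_avg k f x} = (SUP K. emeasure lborel (A K))"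
        unfolding UN by (rule sym)
      then show ?thesis by (simp only: SUP_mult_left_ennreal)
    qed
    also have "\<dots> \<le> ennreal C * (\<integral>\<^sup>+x. (f x)\<^sup>2 \<partial>lborel)" by (intro SUP_least each)
    finally show ?thesis .
  qed
  show ?thesis
  proof (intro exI conjI ballI allI)
    show "C > 0" by (rule C)
  qed (rule claim)
qed

end

section \<open>Almost everywhere convergence\<close>

text \<open>A Urysohn function between a closed set inside and an open set outside differs from the
  indicator by at most 1, and only on the thin set between them. This works for \<open>A\<close> of
  infinite measure too.\<close>

lemma borel_set_approx_by_continuous:
  fixes A :: "real set"
  assumes A: "A \<in> sets borel" and e: "e > 0"
  obtains g :: "real \<Rightarrow> real" where "continuous_on UNIV g"
    "(\<integral>\<^sup>+x. ennreal ((indicator A x - g x)\<^sup>2) \<partial>lborel) < ennreal e"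
proof -
  obtain U where U: "open U" "A \<subseteq> U" "U - A \<in> lmeasurable" "emeasure lebesgue (U - A) < ennreal (e/2)"
    using sets_lebesgue_outer_open[of A "e/2"] A e by auto
  obtain T where T: "closed T" "T \<subseteq> A" "A - T \<in> lmeasurable" "emeasure lebesgue (A - T) < ennreal (e/2)"
    using sets_lebesgue_inner_closed[of A "e/2"] A e by auto
  obtain g :: "real \<Rightarrow> real" where g: "continuous_on UNIV g" "\<And>x. g x \<in> closed_segment 1 0"
      "\<And>x. x \<in> T \<Longrightarrow> g x = 1" "\<And>x. x \<in> - U \<Longrightarrow> g x = 0"
    using Urysohn[of T "- U" "1::real" "0::real"] U T by (auto simp: closed_open)
  have [measurable]: "U \<in> sets borel" "T \<in> sets borel" "A \<in> sets borel" using U T A by auto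
  have "(\<integral>\<^sup>+x. ennreal ((indicator A x - g x)\<^sup>2) \<partial>lborel) \<le> (\<integral>\<^sup>+x. indicator (U - A) x + indicator (A - T) x \<partial>lborel)"
  proof (intro nn_integral_mono)
    fix x
    have "\<bar>indicator A x - g x\<bar> \<le> 1" using g(2)[of x] by (auto simp: closed_segment_eq_real_ivl indicator_def)
    then have "(indicator A x - g x)\<^sup>2 \<le> 1" by (simp add: abs_square_le_1)
    then have *: "ennreal ((indicator A x - g x)\<^sup>2) \<le> 1" using ennreal_leI by fastforce
    consider "x \<in> T" | "x \<notin> U" | "x \<in> U - A" | "x \<in> A - T" using U T by blast
    then show "ennreal ((indicator A x - g x)\<^sup>2) \<le> indicator (U - A) x + indicator (A - T) x"
    proof cases
      case 1 then show ?thesis using T g(3) by (auto simp: indicator_def)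
    next
      case 2 then show ?thesis using U g(4) by (auto simp: indicator_def)
    qed (use * in auto)
  qed
  also have "\<dots> = emeasure lborel (U - A) + emeasure lborel (A - T)"
    by (subst nn_integral_add) auto
  also have "\<dots> < ennreal (e/2) + ennreal (e/2)"
    using U(4) T(4) by (intro add_strict_mono) auto
  also have "\<dots> = ennreal e" using e by (simp flip: ennreal_plus)
  finally show thesis using that g(1) by blast
qed

lemma real_square_add_le: "(a + b)\<^sup>2 \<le> 2 * a\<^sup>2 + 2 * b\<^sup>2" for a b :: real
  using sum_squares_bound[of a b] by (simp add: power2_sum)

lemma nn_integral_square_add_le:
  fixes u v :: "real \<Rightarrow> real"
  assumes [measurable]: "u \<in> borel_measurable borel" "v \<in> borel_measurable borel"
  shows "(\<integral>\<^sup>+x. ennreal ((u x + v x)\<^sup>2) \<partial>lborel)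
    \<le> 2 * (\<integral>\<^sup>+x. ennreal ((u x)\<^sup>2) \<partial>lborel) + 2 * (\<integral>\<^sup>+x. ennreal ((v x)\<^sup>2) \<partial>lborel)"
proof -
  have "(\<integral>\<^sup>+x. ennreal ((u x + v x)\<^sup>2) \<partial>lborel) \<le> (\<integral>\<^sup>+x. 2 * ennreal ((u x)\<^sup>2) + 2 * ennreal ((v x)\<^sup>2) \<partial>lborel)"
  proof (intro nn_integral_mono)
    fix x
    have "ennreal ((u x + v x)\<^sup>2) \<le> ennreal (2 * (u x)\<^sup>2 + 2 * (v x)\<^sup>2)"
      by (intro ennreal_leI real_square_add_le)
    then show "ennreal ((u x + v x)\<^sup>2) \<le> 2 * ennreal ((u x)\<^sup>2) + 2 * ennreal ((v x)\<^sup>2)"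
      by (simp add: ennreal_plus ennreal_mult)
  qed
  also have "\<dots> = 2 * (\<integral>\<^sup>+x. ennreal ((u x)\<^sup>2) \<partial>lborel) + 2 * (\<integral>\<^sup>+x. ennreal ((v x)\<^sup>2) \<partial>lborel)"
    by (simp add: nn_integral_add nn_integral_cmult)
  finally show ?thesis .
qed

lemma ennreal_four_quarters: "0 < e \<Longrightarrow> 2 * ennreal (e / 4) + 2 * ennreal (e / 4) = ennreal e"
proof -
  assume e: "0 < e"
  have "ennreal (2 * (e / 4)) = ennreal 2 * ennreal (e / 4)" by (rule ennreal_mult') simp
  then have "2 * ennreal (e / 4) = ennreal (2 * (e / 4))" by (simp only: ennreal_numeral)
  then show ?thesis using e by (simp flip: ennreal_plus)
qed

text \<open>No compact support or integrability is asked of \<open>g\<close>: the averages at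
  \<open>x\<close> only see the interval from \<open>x - 1\<close> to \<open>x\<close>.\<close>

definition L2_limit_of_continuous :: "(real \<Rightarrow> real) \<Rightarrow> bool" where
  "L2_limit_of_continuous u \<longleftrightarrow> (\<forall>e>0. \<exists>g. continuous_on UNIV g \<and> (\<integral>\<^sup>+x. ennreal ((u x - g x)\<^sup>2) \<partial>lborel) < ennreal e)"

lemma L2_limit_of_continuous_add:
  assumes [measurable]: "u \<in> borel_measurable borel" "v \<in> borel_measurable borel"
    and u: "L2_limit_of_continuous u" and v: "L2_limit_of_continuous v"
  shows "L2_limit_of_continuous (\<lambda>x. u x + v x)"
  unfolding L2_limit_of_continuous_def
proof (intro allI impI)
  fix e :: real assume e: "e > 0"
  obtain g where g: "continuous_on UNIV g" "(\<integral>\<^sup>+x. ennreal ((u x - g x)\<^sup>2) \<partial>lborel) < ennreal (e/4)"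
    using u e unfolding L2_limit_of_continuous_def by (meson zero_less_divide_iff zero_less_numeral)
  obtain h where h: "continuous_on UNIV h" "(\<integral>\<^sup>+x. ennreal ((v x - h x)\<^sup>2) \<partial>lborel) < ennreal (e/4)"
    using v e unfolding L2_limit_of_continuous_def by (meson zero_less_divide_iff zero_less_numeral)
  have [measurable]: "g \<in> borel_measurable borel" "h \<in> borel_measurable borel"
    using g(1) h(1) by (auto intro: borel_measurable_continuous_onI)
  have "(\<integral>\<^sup>+x. ennreal ((u x + v x - (g x + h x))\<^sup>2) \<partial>lborel) = (\<integral>\<^sup>+x. ennreal (((u x - g x) + (v x - h x))\<^sup>2) \<partial>lborel)"
    by (simp add: algebra_simps)
  also have "\<dots> \<le> 2 * (\<integral>\<^sup>+x. ennreal ((u x - g x)\<^sup>2) \<partial>lborel) + 2 * (\<integral>\<^sup>+x. ennreal ((v x - h x)\<^sup>2) \<partial>lborel)"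
    by (intro nn_integral_square_add_le) measurable
  also have "\<dots> < 2 * ennreal (e/4) + 2 * ennreal (e/4)"
    using g(2) h(2) by (intro add_strict_mono ennreal_mult_strict_left_mono) auto
  also have "\<dots> = ennreal e" using e by (rule ennreal_four_quarters)
  finally show "\<exists>g. continuous_on UNIV g \<and> (\<integral>\<^sup>+x. ennreal ((u x + v x - g x)\<^sup>2) \<partial>lborel) < ennreal e"
    using g(1) h(1) by (intro exI[of _ "\<lambda>x. g x + h x"]) (auto intro: continuous_on_add)
qed

lemma L2_limit_of_continuous_cmult:
  assumes [measurable]: "u \<in> borel_measurable borel" and u: "L2_limit_of_continuous u"
  shows "L2_limit_of_continuous (\<lambda>x. c * u x)"
  unfolding L2_limit_of_continuous_def
proof (intro allI impI)
  fix e :: real assume e: "e > 0"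
  define e' where "e' = e / (c\<^sup>2 + 1)"
  have c: "c\<^sup>2 + 1 > 0" by (simp add: add_nonneg_pos)
  then have e': "e' > 0" using e by (simp add: e'_def)
  obtain g where g: "continuous_on UNIV g" "(\<integral>\<^sup>+x. ennreal ((u x - g x)\<^sup>2) \<partial>lborel) < ennreal e'"
    using u e' unfolding L2_limit_of_continuous_def by meson
  have [measurable]: "g \<in> borel_measurable borel" using g(1) by (auto intro: borel_measurable_continuous_onI)
  have "(\<integral>\<^sup>+x. ennreal ((c * u x - c * g x)\<^sup>2) \<partial>lborel) = (\<integral>\<^sup>+x. ennreal (c\<^sup>2) * ennreal ((u x - g x)\<^sup>2) \<partial>lborel)"
    by (simp add: right_diff_distrib[symmetric] power_mult_distrib ennreal_mult)
  also have "\<dots> = ennreal (c\<^sup>2) * (\<integral>\<^sup>+x. ennreal ((u x - g x)\<^sup>2) \<partial>lborel)"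
    by (simp add: nn_integral_cmult)
  also have "\<dots> \<le> ennreal (c\<^sup>2) * ennreal e'" using g(2) by (intro mult_left_mono) auto
  also have "\<dots> < ennreal e"
  proof -
    have "c\<^sup>2 * e < (c\<^sup>2 + 1) * e" using e by (intro mult_strict_right_mono) auto
    then have "c\<^sup>2 * e' < e" using c by (simp add: e'_def field_simps)
    then show ?thesis using e' e by (simp add: ennreal_mult'[symmetric] ennreal_lessI)
  qed
  finally show "\<exists>g. continuous_on UNIV g \<and> (\<integral>\<^sup>+x. ennreal ((c * u x - g x)\<^sup>2) \<partial>lborel) < ennreal e"
    using g(1) by (intro exI[of _ "\<lambda>x. c * g x"]) (auto intro!: continuous_intros)
qed

lemma L2_limit_of_continuous_nonneg:
  fixes u :: "real \<Rightarrow> real"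
  assumes "u \<in> borel_measurable borel" "\<And>x. 0 \<le> u x" "(\<integral>\<^sup>+x. ennreal ((u x)\<^sup>2) \<partial>lborel) < \<infinity>"
  shows "L2_limit_of_continuous u"
proof -
  \<comment> \<open>Finiteness is carried through the induction as a premise; summands and
    approximants inherit it because they are nonnegative and dominated by the whole.\<close>
  have "(\<integral>\<^sup>+x. ennreal ((u x)\<^sup>2) \<partial>lborel) < \<infinity> \<longrightarrow> L2_limit_of_continuous u"
    using assms(1,2)
  proof (induction rule: borel_measurable_induct_real)
    case (set A)
    show ?case
      unfolding L2_limit_of_continuous_def using borel_set_approx_by_continuous[OF set] by metis
  next
    case (mult u c)
    show ?case
    \<comment> \<open>A zero factor gives no information on the integral of \<open>u^2\<close>, so
      the induction hypothesis cannot be used there.\<close>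
    proof (cases "c = 0")
      case True
      then show ?thesis
        unfolding L2_limit_of_continuous_def by (auto intro!: exI[of _ "\<lambda>_. 0"])
    next
      case False
      show ?thesis
      proof
        assume fin: "(\<integral>\<^sup>+x. ennreal ((c * u x)\<^sup>2) \<partial>lborel) < \<infinity>"
        have [measurable]: "u \<in> borel_measurable borel" by (rule mult.hyps)
        have "(\<integral>\<^sup>+x. ennreal ((c * u x)\<^sup>2) \<partial>lborel) = ennreal (c\<^sup>2) * (\<integral>\<^sup>+x. ennreal ((u x)\<^sup>2) \<partial>lborel)"
          by (simp add: power_mult_distrib ennreal_mult nn_integral_cmult)
        then have "(\<integral>\<^sup>+x. ennreal ((u x)\<^sup>2) \<partial>lborel) < \<infinity>"
          using fin False by (auto simp: ennreal_mult_less_top)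
        then show "L2_limit_of_continuous (\<lambda>x. c * u x)"
          using mult by (intro L2_limit_of_continuous_cmult) auto
      qed
    qed
  next
    case (add u v)
    show ?case
    proof
      assume fin: "(\<integral>\<^sup>+x. ennreal ((v x + u x)\<^sup>2) \<partial>lborel) < \<infinity>"
      have "(\<integral>\<^sup>+x. ennreal ((u x)\<^sup>2) \<partial>lborel) \<le> (\<integral>\<^sup>+x. ennreal ((v x + u x)\<^sup>2) \<partial>lborel)"
        "(\<integral>\<^sup>+x. ennreal ((v x)\<^sup>2) \<partial>lborel) \<le> (\<integral>\<^sup>+x. ennreal ((v x + u x)\<^sup>2) \<partial>lborel)"
        using add.hyps by (auto intro!: nn_integral_mono ennreal_leI power_mono)
      then show "L2_limit_of_continuous (\<lambda>x. v x + u x)"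
        using add fin by (intro L2_limit_of_continuous_add) auto
    qed
  next
    case (seq U)
    show ?case
    proof
      assume fin: "(\<integral>\<^sup>+x. ennreal ((u x)\<^sup>2) \<partial>lborel) < \<infinity>"
      have [measurable]: "U i \<in> borel_measurable borel" "u \<in> borel_measurable borel" for i
        using seq.hyps(1)[of i] assms(1) by auto
      have lim: "(\<lambda>i. U i x) \<longlonglongrightarrow> u x" for x using seq.hyps(4) by simp
      have le: "U i x \<le> u x" for i x
        using seq.hyps(3) lim[of x] by (intro incseq_le) (auto simp: incseq_def le_fun_def)
      have "(\<lambda>i. \<integral>\<^sup>+x. ennreal ((u x - U i x)\<^sup>2) \<partial>lborel) \<longlonglongrightarrow> (\<integral>\<^sup>+(x::real). 0 \<partial>lborel)"
      proof (rule nn_integral_dominated_convergence[where w="\<lambda>x. ennreal ((u x)\<^sup>2)"])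
        show "AE x in lborel. ennreal ((u x - U i x)\<^sup>2) \<le> ennreal ((u x)\<^sup>2)" for i
          using le[of i] seq.hyps(2)[of i] by (auto intro!: ennreal_leI power_mono)
        show "AE x in lborel. (\<lambda>i. ennreal ((u x - U i x)\<^sup>2)) \<longlonglongrightarrow> 0"
        proof (intro AE_I2)
          fix x
          have "(\<lambda>i. (u x - U i x)\<^sup>2) \<longlonglongrightarrow> (u x - u x)\<^sup>2" by (intro tendsto_intros lim)
          then show "(\<lambda>i. ennreal ((u x - U i x)\<^sup>2)) \<longlonglongrightarrow> 0"
            using tendsto_ennrealI by fastforce
        qed
      qed (use fin in auto)
      then have conv: "(\<lambda>i. \<integral>\<^sup>+x. ennreal ((u x - U i x)\<^sup>2) \<partial>lborel) \<longlonglongrightarrow> 0" by simp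
      show "L2_limit_of_continuous u"
        unfolding L2_limit_of_continuous_def
      proof (intro allI impI)
        fix e :: real assume e: "e > 0"
        have "eventually (\<lambda>i. (\<integral>\<^sup>+x. ennreal ((u x - U i x)\<^sup>2) \<partial>lborel) < ennreal (e/4)) sequentially"
          using conv e by (intro order_tendstoD(2)) auto
        then obtain i where i: "(\<integral>\<^sup>+x. ennreal ((u x - U i x)\<^sup>2) \<partial>lborel) < ennreal (e/4)"
          using eventually_happens'[OF sequentially_bot] by blast
        have "(\<integral>\<^sup>+x. ennreal ((U i x)\<^sup>2) \<partial>lborel) \<le> (\<integral>\<^sup>+x. ennreal ((u x)\<^sup>2) \<partial>lborel)"
          using le seq.hyps(2) by (intro nn_integral_mono ennreal_leI power_mono) auto
        then have "(\<integral>\<^sup>+x. ennreal ((U i x)\<^sup>2) \<partial>lborel) < \<infinity>" using fin by (rule le_less_trans)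
        then have "L2_limit_of_continuous (U i)" using seq.IH by blast
        then obtain g where g: "continuous_on UNIV g" "(\<integral>\<^sup>+x. ennreal ((U i x - g x)\<^sup>2) \<partial>lborel) < ennreal (e/4)"
          using e unfolding L2_limit_of_continuous_def by (meson zero_less_divide_iff zero_less_numeral)
        have [measurable]: "g \<in> borel_measurable borel" using g(1) by (auto intro: borel_measurable_continuous_onI)
        have "(\<integral>\<^sup>+x. ennreal ((u x - g x)\<^sup>2) \<partial>lborel) = (\<integral>\<^sup>+x. ennreal (((u x - U i x) + (U i x - g x))\<^sup>2) \<partial>lborel)"
          by simp
        also have "\<dots> \<le> 2 * (\<integral>\<^sup>+x. ennreal ((u x - U i x)\<^sup>2) \<partial>lborel) + 2 * (\<integral>\<^sup>+x. ennreal ((U i x - g x)\<^sup>2) \<partial>lborel)"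
          by (intro nn_integral_square_add_le) measurable
        also have "\<dots> < 2 * ennreal (e/4) + 2 * ennreal (e/4)"
          using g(2) i by (intro add_strict_mono ennreal_mult_strict_left_mono) auto
        also have "\<dots> = ennreal e" using e by (rule ennreal_four_quarters)
        finally show "\<exists>g. continuous_on UNIV g \<and> (\<integral>\<^sup>+x. ennreal ((u x - g x)\<^sup>2) \<partial>lborel) < ennreal e"
          using g(1) by blast
      qed
    qed
  qed
  then show ?thesis using assms(3) by simp
qed

lemma L2_approx_by_continuous:
  fixes f :: "real \<Rightarrow> complex"
  assumes f [measurable]: "f \<in> borel_measurable borel"
    and fin: "(\<integral>\<^sup>+x. ennreal ((norm (f x))\<^sup>2) \<partial>lborel) < \<infinity>" and e: "e > 0"
  obtains g :: "real \<Rightarrow> complex" where "continuous_on UNIV g"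
    "(\<integral>\<^sup>+x. ennreal ((norm (f x - g x))\<^sup>2) \<partial>lborel) < ennreal e"
proof -
  have part: "L2_limit_of_continuous p" if [measurable]: "p \<in> borel_measurable borel" and p: "\<And>x. \<bar>p x\<bar> \<le> norm (f x)" for p
  proof -
    have fin': "(\<integral>\<^sup>+x. ennreal ((q x)\<^sup>2) \<partial>lborel) < \<infinity>" if q: "\<And>x. \<bar>q x\<bar> \<le> \<bar>p x\<bar>" for q :: "real \<Rightarrow> real"
    proof -
      have "(q x)\<^sup>2 \<le> (norm (f x))\<^sup>2" for x
        using q[of x] p[of x] by (metis abs_ge_zero order_trans power2_abs power_mono)
      then have "(\<integral>\<^sup>+x. ennreal ((q x)\<^sup>2) \<partial>lborel) \<le> (\<integral>\<^sup>+x. ennreal ((norm (f x))\<^sup>2) \<partial>lborel)"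
        by (intro nn_integral_mono ennreal_leI)
      then show ?thesis using fin by (rule le_less_trans)
    qed
    have "L2_limit_of_continuous (\<lambda>x. max 0 (p x))" "L2_limit_of_continuous (\<lambda>x. max 0 (- p x))"
      by (intro L2_limit_of_continuous_nonneg fin'; auto)+
    then have "L2_limit_of_continuous (\<lambda>x. max 0 (p x) + (- 1) * max 0 (- p x))"
      by (intro L2_limit_of_continuous_add L2_limit_of_continuous_cmult) auto
    moreover have "(\<lambda>x. max 0 (p x) + (- 1) * max 0 (- p x)) = p" by (auto simp: max_def)
    ultimately show ?thesis by simp
  qed
  have "L2_limit_of_continuous (\<lambda>x. Re (f x))" "L2_limit_of_continuous (\<lambda>x. Im (f x))"
    by (intro part; auto simp: abs_Re_le_cmod abs_Im_le_cmod)+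
  then obtain g h where g: "continuous_on UNIV g" "(\<integral>\<^sup>+x. ennreal ((Re (f x) - g x)\<^sup>2) \<partial>lborel) < ennreal (e/2)"
    and h: "continuous_on UNIV h" "(\<integral>\<^sup>+x. ennreal ((Im (f x) - h x)\<^sup>2) \<partial>lborel) < ennreal (e/2)"
    using e unfolding L2_limit_of_continuous_def by (meson half_gt_zero)
  have [measurable]: "g \<in> borel_measurable borel" "h \<in> borel_measurable borel"
    using g(1) h(1) by (auto intro: borel_measurable_continuous_onI)
  have "(\<integral>\<^sup>+x. ennreal ((norm (f x - Complex (g x) (h x)))\<^sup>2) \<partial>lborel)
      = (\<integral>\<^sup>+x. ennreal ((Re (f x) - g x)\<^sup>2) + ennreal ((Im (f x) - h x)\<^sup>2) \<partial>lborel)"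
    by (simp add: cmod_power2)
  also have "\<dots> = (\<integral>\<^sup>+x. ennreal ((Re (f x) - g x)\<^sup>2) \<partial>lborel) + (\<integral>\<^sup>+x. ennreal ((Im (f x) - h x)\<^sup>2) \<partial>lborel)"
    by (rule nn_integral_add) measurable
  also have "\<dots> < ennreal (e/2) + ennreal (e/2)" using g h by (intro add_strict_mono)
  also have "\<dots> = ennreal e" using e by (simp flip: ennreal_plus)
  finally show thesis using g(1) h(1) by (intro that[of "\<lambda>x. Complex (g x) (h x)"]) (auto intro!: continuous_intros simp: Complex_eq)
qed

section \<open>Convergence for square-integrable Borel functions\<close>

context digit_system
begin

lemma continuous_average_converges:
  fixes g :: "real \<Rightarrow> complex"
  assumes g: "continuous_on UNIV g"
  shows "integrable \<nu> (\<lambda>t. g (x - t / real d ^ k))"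
    and "(\<lambda>k. \<integral>t. g (x - t / real d ^ k) \<partial>\<nu>) \<longlonglongrightarrow> g x"
proof -
  have [measurable]: "g \<in> borel_measurable borel" using g by (auto intro: borel_measurable_continuous_onI)
  have "compact (g ` {x - 1..x})" using g by (intro compact_continuous_image continuous_on_subset[OF g]) auto
  then obtain M where M: "\<And>y. y \<in> {x - 1..x} \<Longrightarrow> norm (g y) \<le> M"
    using compact_imp_bounded bounded_iff by (metis imageI)
  have bound: "AE t in \<nu>. norm (g (x - t / real d ^ k)) \<le> M" for k
    using AE_\<nu>_bounds
  proof eventually_elim
    case (elim t)
    have "1 \<le> real d ^ k" using d by simp
    then have "0 \<le> t / real d ^ k" "t / real d ^ k \<le> 1"
      using elim by (auto simp: divide_le_eq_1)
    then show ?case by (intro M) auto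
  qed
  show "integrable \<nu> (\<lambda>t. g (x - t / real d ^ k))" for k
    by (rule \<nu>.integrable_const_bound[OF bound]) measurable
  have "(\<lambda>k. \<integral>t. g (x - t / real d ^ k) \<partial>\<nu>) \<longlonglongrightarrow> (\<integral>t. g x \<partial>\<nu>)"
  proof (rule integral_dominated_convergence[where w="\<lambda>_. M"])
    show "AE t in \<nu>. (\<lambda>k. g (x - t / real d ^ k)) \<longlonglongrightarrow> g x"
    proof (intro AE_I2)
      fix t
      have "(\<lambda>k. t * (1 / real d) ^ k) \<longlonglongrightarrow> t * 0"
        using d by (intro tendsto_mult tendsto_const LIMSEQ_power_zero) auto
      then have "(\<lambda>k. x - t / real d ^ k) \<longlonglongrightarrow> x"
        using tendsto_diff[OF tendsto_const[of x]] by (fastforce simp: power_divide)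
      then show "(\<lambda>k. g (x - t / real d ^ k)) \<longlonglongrightarrow> g x"
        using g by (auto intro: continuous_on_tendsto_compose)
    qed
  qed (use bound in auto)
  then show "(\<lambda>k. \<integral>t. g (x - t / real d ^ k) \<partial>\<nu>) \<longlonglongrightarrow> g x"
    using \<nu>.prob_space[simplified] by simp
qed

lemma AE_cantor_avg_finite:
  assumes [measurable]: "u \<in> borel_measurable borel" and fin: "(\<integral>\<^sup>+x. (u x)\<^sup>2 \<partial>lborel) < \<infinity>"
  shows "AE x in lborel. cantor_avg k u x < \<infinity>"
proof -
  have "(\<integral>\<^sup>+x. (cantor_avg k u x)\<^sup>2 \<partial>lborel) < \<infinity>"
    using nn_integral_cantor_avg_squared_le[OF assms(1)] fin by (rule le_less_trans)
  then have "AE x in lborel. (cantor_avg k u x)\<^sup>2 \<noteq> \<infinity>"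
    by (intro nn_integral_PInf_AE) auto
  then show ?thesis by eventually_elim (auto simp: less_top power_eq_top_ennreal)
qed

lemma AE_averages_converge:
  fixes f :: "real \<Rightarrow> complex"
  assumes f [measurable]: "f \<in> borel_measurable borel"
    and fin: "(\<integral>\<^sup>+x. ennreal ((norm (f x))\<^sup>2) \<partial>lborel) < \<infinity>"
  shows "AE x in lborel. (\<forall>k. integrable \<nu> (\<lambda>t. f (x - t / real d ^ k))) \<and>
    ((\<lambda>k. \<integral>t. f (x - t / real d ^ k) \<partial>\<nu>) \<longlonglongrightarrow> f x)"
proof -
  define F where "F = (\<lambda>x. ennreal (norm (f x)))"
  have [measurable]: "F \<in> borel_measurable borel" by (simp add: F_def)
  have "(\<integral>\<^sup>+x. (F x)\<^sup>2 \<partial>lborel) < \<infinity>" using fin by (simp add: F_def ennreal_power)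
  then have "AE x in lborel. cantor_avg k F x < \<infinity>" for k by (intro AE_cantor_avg_finite) auto
  then have "AE x in lborel. \<forall>k. cantor_avg k F x < \<infinity>" unfolding AE_all_countable by blast
  then have int_AE: "AE x in lborel. \<forall>k. integrable \<nu> (\<lambda>t. f (x - t / real d ^ k))"
    by eventually_elim (auto simp: integrable_iff_bounded cantor_avg_def F_def)
  obtain C :: real where C: "C > 0" and weak: "\<And>u c. u \<in> borel_measurable borel \<Longrightarrow>
      c\<^sup>2 * emeasure lborel {x. \<exists>k. c < cantor_avg k u x} \<le> ennreal C * (\<integral>\<^sup>+x. (u x)\<^sup>2 \<partial>lborel)"
    using weak_type_inequality by auto
  \<comment> \<open>The three \<open>\<eta>\<close> bound the average of \<open>f - g\<close>, the
    convergence for \<open>g\<close>, and \<open>g x - f x\<close>. Integrability is a premise so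
    that the integral of \<open>f - g\<close> may be split.\<close>
  have close_AE: "AE x in lborel. (\<forall>k. integrable \<nu> (\<lambda>t. f (x - t / real d ^ k))) \<longrightarrow>
      (\<forall>\<^sub>F k in sequentially. norm ((\<integral>t. f (x - t / real d ^ k) \<partial>\<nu>) - f x) \<le> 3 * \<eta>)"
    if \<eta>: "\<eta> > 0" for \<eta> :: real
  proof -
    have "\<exists>S. S \<in> sets lborel \<and> emeasure lborel S \<le> ennreal (1 / Suc n) \<and>
        (\<forall>x. x \<notin> S \<longrightarrow> (\<forall>k. integrable \<nu> (\<lambda>t. f (x - t / real d ^ k))) \<longrightarrow>
          (\<forall>\<^sub>F k in sequentially. norm ((\<integral>t. f (x - t / real d ^ k) \<partial>\<nu>) - f x) \<le> 3 * \<eta>))" for n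
    proof -
      \<comment> \<open>The weak-type inequality costs \<open>C * e / \<eta>^2\<close> and Chebyshev
        for \<open>f - g\<close> costs \<open>e / \<eta>^2\<close>; together they give
        \<open>1 / Suc n\<close>.\<close>
      define e where "e = \<eta>\<^sup>2 / ((C + 1) * Suc n)"
      have e: "e > 0" using \<eta> C by (simp add: e_def)
      obtain g where g: "continuous_on UNIV g" "(\<integral>\<^sup>+x. ennreal ((norm (f x - g x))\<^sup>2) \<partial>lborel) < ennreal e"
        using L2_approx_by_continuous[OF f fin e] .
      have [measurable]: "g \<in> borel_measurable borel" using g(1) by (auto intro: borel_measurable_continuous_onI)
      define u where "u = (\<lambda>x. ennreal (norm (f x - g x)))"
      have u [measurable]: "u \<in> borel_measurable borel" by (simp add: u_def)
      have u2: "(\<integral>\<^sup>+x. (u x)\<^sup>2 \<partial>lborel) \<le> ennreal e" using g(2) by (simp add: u_def ennreal_power)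
      define S1 where "S1 = {x. \<exists>k. ennreal \<eta> < cantor_avg k u x}"
      define S2 where "S2 = {x. ennreal \<eta> < u x}"
      have sets_S [measurable]: "S1 \<in> sets lborel" "S2 \<in> sets lborel" unfolding S1_def S2_def by measurable
      have S1: "ennreal (\<eta>\<^sup>2) * emeasure lborel S1 \<le> ennreal (C * e)"
      proof -
        have "(ennreal \<eta>)\<^sup>2 * emeasure lborel S1 \<le> ennreal C * (\<integral>\<^sup>+x. (u x)\<^sup>2 \<partial>lborel)"
          unfolding S1_def by (rule weak[OF u])
        also have "\<dots> \<le> ennreal C * ennreal e" by (intro mult_left_mono u2) auto
        finally show ?thesis using \<eta> C by (simp add: ennreal_power ennreal_mult')
      qed
      have S2: "ennreal (\<eta>\<^sup>2) * emeasure lborel S2 \<le> ennreal e"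
      proof -
        have "ennreal (\<eta>\<^sup>2) * emeasure lborel S2 = (\<integral>\<^sup>+x. ennreal (\<eta>\<^sup>2) * indicator S2 x \<partial>lborel)"
          by (rule nn_integral_cmult_indicator[symmetric]) measurable
        also have "\<dots> \<le> (\<integral>\<^sup>+x. (u x)\<^sup>2 \<partial>lborel)"
        proof (intro nn_integral_mono)
          fix x
          show "ennreal (\<eta>\<^sup>2) * indicator S2 x \<le> (u x)\<^sup>2"
          proof (cases "x \<in> S2")
            case True
            then have "(ennreal \<eta>)\<^sup>2 \<le> (u x)\<^sup>2" by (intro power_mono) (auto simp: S2_def)
            then show ?thesis using True \<eta> by (simp add: ennreal_power)
          qed simp
        qed
        finally show ?thesis using u2 by simp
      qed
      have "ennreal (\<eta>\<^sup>2) * emeasure lborel (S1 \<union> S2) \<le> ennreal (\<eta>\<^sup>2) * (emeasure lborel S1 + emeasure lborel S2)"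
        by (intro mult_left_mono emeasure_subadditive sets_S) simp
      also have "\<dots> \<le> ennreal (C * e) + ennreal e" using S1 S2 by (simp add: distrib_left add_mono)
      also have "\<dots> = ennreal ((C + 1) * e)" using C e by (simp add: ennreal_plus[symmetric] algebra_simps del: ennreal_plus)
      also have "(C + 1) * e = \<eta>\<^sup>2 * (1 / Suc n)"
      proof -
        have "C + 1 \<noteq> 0" using C by simp
        then show ?thesis by (simp add: e_def del: of_nat_Suc)
      qed
      also have "ennreal \<dots> = ennreal (\<eta>\<^sup>2) * ennreal (1 / Suc n)" by (rule ennreal_mult') simp
      finally have small: "emeasure lborel (S1 \<union> S2) \<le> ennreal (1 / Suc n)"
        using \<eta> by (subst (asm) ennreal_mult_le_mult_iff) auto
      have "\<forall>\<^sub>F k in sequentially. norm ((\<integral>t. f (x - t / real d ^ k) \<partial>\<nu>) - f x) \<le> 3 * \<eta>"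
        if x: "x \<notin> S1 \<union> S2" and int: "\<forall>k. integrable \<nu> (\<lambda>t. f (x - t / real d ^ k))" for x
      proof -
        have "\<forall>\<^sub>F k in sequentially. dist (\<integral>t. g (x - t / real d ^ k) \<partial>\<nu>) (g x) < \<eta>"
          using continuous_average_converges(2)[OF g(1)] \<eta> by (rule tendstoD)
        then show ?thesis
        proof eventually_elim
          case (elim k)
          have ig: "integrable \<nu> (\<lambda>t. g (x - t / real d ^ k))" by (rule continuous_average_converges(1)[OF g(1)])
          have fg: "norm ((\<integral>t. f (x - t / real d ^ k) \<partial>\<nu>) - (\<integral>t. g (x - t / real d ^ k) \<partial>\<nu>)) \<le> \<eta>"
          proof -
            have "ennreal (norm (\<integral>t. f (x - t / real d ^ k) - g (x - t / real d ^ k) \<partial>\<nu>))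
                \<le> (\<integral>\<^sup>+t. norm (f (x - t / real d ^ k) - g (x - t / real d ^ k)) \<partial>\<nu>)"
              using int ig by (intro integral_norm_bound_ennreal) auto
            also have "\<dots> = cantor_avg k u x" by (simp add: cantor_avg_def u_def)
            also have "\<dots> \<le> ennreal \<eta>" using x by (auto simp: S1_def not_less)
            finally show ?thesis using int ig \<eta> by (simp add: ennreal_le_iff)
          qed
          have gf: "norm (g x - f x) \<le> \<eta>"
            using x \<eta> by (auto simp: S2_def u_def not_less ennreal_le_iff norm_minus_commute)
          have "norm ((\<integral>t. f (x - t / real d ^ k) \<partial>\<nu>) - f x)
              \<le> norm ((\<integral>t. f (x - t / real d ^ k) \<partial>\<nu>) - (\<integral>t. g (x - t / real d ^ k) \<partial>\<nu>))
                + norm ((\<integral>t. g (x - t / real d ^ k) \<partial>\<nu>) - g x) + norm (g x - f x)"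
            by (smt (verit) norm_diff_triangle_le norm_triangle_le_diff order_refl)
          then show ?case using fg gf elim by (simp add: dist_norm)
        qed
      qed
      then show ?thesis using small sets.Un[OF sets_S] by (intro exI[of _ "S1 \<union> S2"]) auto
    qed
    then obtain S where S: "\<And>n. S n \<in> sets lborel" "\<And>n. emeasure lborel (S n) \<le> ennreal (1 / Suc n)"
      and conv: "\<And>n x. x \<notin> S n \<Longrightarrow> (\<forall>k. integrable \<nu> (\<lambda>t. f (x - t / real d ^ k))) \<Longrightarrow>
          (\<forall>\<^sub>F k in sequentially. norm ((\<integral>t. f (x - t / real d ^ k) \<partial>\<nu>) - f x) \<le> 3 * \<eta>)"
      by metis
    have "emeasure lborel (\<Inter>n. S n) \<le> 0"
    proof (rule LIMSEQ_le_const)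
      show "(\<lambda>n. ennreal (1 / Suc n)) \<longlonglongrightarrow> 0"
        using tendsto_ennrealI[OF LIMSEQ_inverse_real_of_nat] by (simp add: inverse_eq_divide)
      show "\<exists>N. \<forall>n\<ge>N. emeasure lborel (\<Inter>n. S n) \<le> ennreal (1 / Suc n)"
        using S by (intro exI[of _ 0] allI impI order_trans[OF emeasure_mono S(2)]) auto
    qed
    then have "(\<Inter>n. S n) \<in> null_sets lborel" using S(1) by (auto simp: null_sets_def)
    then show ?thesis
    proof (rule AE_I')
      show "{x \<in> space lborel. \<not> ((\<forall>k. integrable \<nu> (\<lambda>t. f (x - t / real d ^ k))) \<longrightarrow>
        (\<forall>\<^sub>F k in sequentially. norm ((\<integral>t. f (x - t / real d ^ k) \<partial>\<nu>) - f x) \<le> 3 * \<eta>))} \<subseteq> (\<Inter>n. S n)"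
        using conv by blast
    qed
  qed
  have "AE x in lborel. \<forall>m. (\<forall>k. integrable \<nu> (\<lambda>t. f (x - t / real d ^ k))) \<longrightarrow>
      (\<forall>\<^sub>F k in sequentially. norm ((\<integral>t. f (x - t / real d ^ k) \<partial>\<nu>) - f x) \<le> 3 * (1 / Suc m))"
    unfolding AE_all_countable by (intro allI close_AE) simp
  with int_AE show ?thesis
  proof eventually_elim
    case (elim x)
    have "(\<lambda>k. \<integral>t. f (x - t / real d ^ k) \<partial>\<nu>) \<longlonglongrightarrow> f x"
    proof (rule tendstoI)
      fix e :: real assume "e > 0"
      then obtain m where m: "1 / Suc m < e / 3" using nat_approx_posE[of "e/3"] by auto
      have "\<forall>\<^sub>F k in sequentially. norm ((\<integral>t. f (x - t / real d ^ k) \<partial>\<nu>) - f x) \<le> 3 * (1 / Suc m)"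
        using elim by blast
      then show "\<forall>\<^sub>F k in sequentially. dist (\<integral>t. f (x - t / real d ^ k) \<partial>\<nu>) (f x) < e"
        by eventually_elim (use m in \<open>simp add: dist_norm\<close>)
    qed
    with elim show ?case by blast
  qed
qed

end

section \<open>Lebesgue measurable and locally square-integrable functions\<close>

lemma borel_representative:
  fixes f :: "real \<Rightarrow> complex"
  assumes f: "f \<in> borel_measurable lebesgue"
  obtains f' N where "f' \<in> borel_measurable borel" "N \<in> null_sets lborel" "\<And>x. x \<notin> N \<Longrightarrow> f x = f' x"
proof -
  have "(\<lambda>x. Re (f x)) \<in> borel_measurable lebesgue" "(\<lambda>x. Im (f x)) \<in> borel_measurable lebesgue"
    using f by measurable
  then obtain p q where p: "p \<in> borel_measurable lborel" "AE x in lborel. Re (f x) = p x"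
    and q: "q \<in> borel_measurable lborel" "AE x in lborel. Im (f x) = q x"
    using completion_ex_borel_measurable_real by metis
  have "AE x in lborel. f x = Complex (p x) (q x)"
    using p(2) q(2) by eventually_elim (simp add: complex_eq_iff)
  then obtain N where N: "{x \<in> space lborel. f x \<noteq> Complex (p x) (q x)} \<subseteq> N" "emeasure lborel N = 0" "N \<in> sets lborel"
    by (rule AE_E)
  show thesis
  proof (rule that)
    show "(\<lambda>x. Complex (p x) (q x)) \<in> borel_measurable borel" using p(1) q(1) by (simp add: Complex_eq)
    show "N \<in> null_sets lborel" using N by (auto simp: null_sets_def)
    show "f x = Complex (p x) (q x)" if "x \<notin> N" for x using N(1) that by auto
  qed
qed

text \<open>Even measurability of \<open>f\<close> is a conclusion here: in the completion, agreeing
  almost everywhere with a measurable function is enough.\<close>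

lemma completion_integral_AE_eq:
  fixes f g :: "'a \<Rightarrow> complex"
  assumes g: "g \<in> borel_measurable M" and eq: "AE t in M. f t = g t"
  shows "integrable (completion M) f \<longleftrightarrow> integrable M g" "integral\<^sup>L (completion M) f = integral\<^sup>L M g"
proof -
  have g': "g \<in> borel_measurable (completion M)" using g by (rule measurable_completion)
  have eq': "AE t in completion M. f t = g t" using eq by (rule AE_completion)
  have f': "f \<in> borel_measurable (completion M)"
  proof (rule measurableI)
    fix A :: "complex set" assume A: "A \<in> sets borel"
    show "f -` A \<inter> space (completion M) \<in> sets (completion M)"
    proof (rule completion.in_sets_AE)
      show "g -` A \<inter> space (completion M) \<in> sets (completion M)" using g' A by (rule measurable_sets)
      show "AE x in completion M. (x \<in> g -` A \<inter> space (completion M)) = (x \<in> f -` A \<inter> space (completion M))"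
        using eq' by eventually_elim auto
    qed auto
  qed auto
  have "integrable (completion M) f \<longleftrightarrow> integrable (completion M) g"
    by (rule integrable_cong_AE[OF f' g' eq'])
  then show "integrable (completion M) f \<longleftrightarrow> integrable M g" by (simp add: integrable_completion[OF g])
  have "integral\<^sup>L (completion M) f = integral\<^sup>L (completion M) g"
    by (rule integral_cong_AE[OF f' g' eq'])
  then show "integral\<^sup>L (completion M) f = integral\<^sup>L M g" by (simp add: integral_completion[OF g])
qed

text \<open>The completion appears because \<open>f\<close> is only Lebesgue measurable, so
  \<open>t \<mapsto> f (x - t / d^k)\<close> need not be Borel measurable. Integrability is part of
  the claim because the Bochner integral of a non-integrable function is 0 by convention.\<close>

theorem corollary1p5:
  fixes d :: nat and D :: "nat set" and f :: "real \<Rightarrow> complex"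
  assumes "3 \<le> d"
    and "D \<subset> {0..<d}"
    and "2 \<le> card D"
    and "0 \<in> D"
    and "f \<in> L2_loc"
  shows "AE x in lebesgue.
           (\<forall>k. integrable (completion (natural_measure d D)) (\<lambda>t. f (x - t / real d ^ k))) \<and>
           ((\<lambda>k. \<integral>t. f (x - t / real d ^ k) \<partial>completion (natural_measure d D)) \<longlonglongrightarrow> f x)"
proof -
  interpret digit_system d D using assms by unfold_locales auto
  have f: "f \<in> borel_measurable lebesgue"
    and loc: "\<And>K. compact K \<Longrightarrow> set_integrable lebesgue K (\<lambda>x. (norm (f x))\<^sup>2)"
    using assms(5) by (auto simp: L2_loc_def)
  obtain f' N where f' [measurable]: "f' \<in> borel_measurable borel" and N: "N \<in> null_sets lborel"
    and ff': "\<And>x. x \<notin> N \<Longrightarrow> f x = f' x"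
    using borel_representative[OF f] by blast
  have [measurable]: "N \<in> sets borel" using N by auto
  \<comment> \<open>The extra unit on the left makes this interval contain every point
    \<open>x - t / d^k\<close> with \<open>|x| \<le> B\<close> and \<open>t\<close> between 0 and 1,
    so the cutoff leaves the averages at such \<open>x\<close> unchanged.\<close>
  define h where "h = (\<lambda>B x. indicator {- real B - 1..real B} x *\<^sub>R f' x)"
  have h [measurable]: "h B \<in> borel_measurable borel" for B unfolding h_def by measurable
  have fin: "(\<integral>\<^sup>+x. ennreal ((norm (h B x))\<^sup>2) \<partial>lborel) < \<infinity>" for B
  proof -
    define I where "I = {- real B - 1..real B}"
    have "integrable lebesgue (\<lambda>x. indicator I x *\<^sub>R (norm (f x))\<^sup>2)"
      using loc[of I] by (simp add: I_def set_integrable_def)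
    then have "(\<integral>\<^sup>+x. ennreal (norm (indicator I x *\<^sub>R (norm (f x))\<^sup>2)) \<partial>lebesgue) < \<infinity>"
      by (simp add: integrable_iff_bounded)
    then have "(\<integral>\<^sup>+x. ennreal (norm (indicator I x *\<^sub>R (norm (f x))\<^sup>2)) \<partial>lborel) < \<infinity>"
      by (simp add: nn_integral_completion)
    moreover have "(\<integral>\<^sup>+x. ennreal ((norm (h B x))\<^sup>2) \<partial>lborel) = (\<integral>\<^sup>+x. ennreal (norm (indicator I x *\<^sub>R (norm (f x))\<^sup>2)) \<partial>lborel)"
    proof (rule nn_integral_cong_AE)
      show "AE x in lborel. ennreal ((norm (h B x))\<^sup>2) = ennreal (norm (indicator I x *\<^sub>R (norm (f x))\<^sup>2))"
        using AE_not_in[OF N] by eventually_elim (auto simp: h_def I_def ff' indicator_def)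
    qed
    ultimately show ?thesis by simp
  qed
  have conv: "AE x in lborel. \<forall>B. (\<forall>k. integrable \<nu> (\<lambda>t. h B (x - t / real d ^ k))) \<and>
      ((\<lambda>k. \<integral>t. h B (x - t / real d ^ k) \<partial>\<nu>) \<longlonglongrightarrow> h B x)"
    unfolding AE_all_countable by (intro allI AE_averages_converge h fin)
  \<comment> \<open>The natural measure may charge Lebesgue null sets, so changing \<open>f\<close>
    on \<open>N\<close> could alter individual averages. Averaging preserves the integral over the
    line, which rules this out for almost every \<open>x\<close>.\<close>
  have "AE x in lborel. cantor_avg k (indicator N) x = 0" for k
  proof -
    have "(\<integral>\<^sup>+x. cantor_avg k (indicator N) x \<partial>lborel) = 0"
      using N by (subst nn_integral_cantor_avg) (auto simp: null_sets_def)
    then show ?thesis by (subst (asm) nn_integral_0_iff_AE) auto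
  qed
  then have avoid: "AE x in lborel. \<forall>k. AE t in \<nu>. x - t / real d ^ k \<notin> N"
    unfolding AE_all_countable
  proof (intro allI)
    fix k assume *: "\<And>k. AE x in lborel. cantor_avg k (indicator N) x = 0"
    show "AE x in lborel. AE t in \<nu>. x - t / real d ^ k \<notin> N"
      using *[of k]
    proof eventually_elim
      case (elim x)
      then have "AE t in \<nu>. indicator N (x - t / real d ^ k) = (0 :: ennreal)"
        unfolding cantor_avg_def by (subst (asm) nn_integral_0_iff_AE) auto
      then show ?case by eventually_elim (simp add: indicator_eq_0_iff)
    qed
  qed
  have "AE x in lborel.
           (\<forall>k. integrable (completion \<nu>) (\<lambda>t. f (x - t / real d ^ k))) \<and>
           ((\<lambda>k. \<integral>t. f (x - t / real d ^ k) \<partial>completion \<nu>) \<longlonglongrightarrow> f x)"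
    using conv avoid AE_not_in[OF N]
  proof eventually_elim
    case (elim x)
    obtain B :: nat where B: "\<bar>x\<bar> \<le> real B" using real_arch_simple by blast
    have hx: "h B x = f x" using B elim(3) by (auto simp: h_def ff' indicator_def)
    have eq: "AE t in \<nu>. f (x - t / real d ^ k) = h B (x - t / real d ^ k)" for k
      using AE_\<nu>_bounds elim(2)[rule_format, of k]
    proof eventually_elim
      case (elim t)
      have "1 \<le> real d ^ k" using d by simp
      then have "0 \<le> t / real d ^ k" "t / real d ^ k \<le> 1"
        using elim by (auto simp: divide_le_eq_1)
      then have "x - t / real d ^ k \<in> {- real B - 1..real B}" using B by auto
      then show ?case using elim by (simp add: h_def ff')
    qed
    have "(\<lambda>t. h B (x - t / real d ^ k)) \<in> borel_measurable \<nu>" for k by measurable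
    note completion_integral_AE_eq[OF this eq]
    then show ?case using elim(1)[rule_format, of B] hx by simp
  qed
  then show ?thesis by (rule AE_completion)
qed

end
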